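(* Let $\boldsymbol\lambda,\mathbf d,n$ be as in the context and $A=A_{\boldsymbol\lambda,\mathbf d}$, $\Delta_A=\Delta(Q_{n\times n},A)$. (1) The map $\Phi_{\boldsymbol\lambda,\mathbf d}$ restricts to a weight preserving bijection from ${\tt StableFacet}(\boldsymbol\lambda,\mathbf d)$ onto the set $F(\Delta_A)$ of facets of $\Delta_A$. (2) This bijection restricts to a bijection from ${\tt Prism}(\boldsymbol\lambda,\mathbf d)$ onto $F_{\tt max}(\Delta_A)$, the set of faces of $\Delta_A$ of maximum dimension.
   Context: $\boldsymbol\lambda=(\lambda^{(1)},\ldots,\lambda^{(k)})$ partitions, $\mathbf d=(d_1,\ldots,d_k)$ positive integers with $\ell(\lambda^{(i)})\le d_i$, $n$ with $\lambda^{(i)}_1\le n-d_i$. ASMs: square matrices with entries in $\{-1,0,1\}$, nonzero entries alternating in sign along rows and columns, row and column sums 1; $A\le B$ iff $r_A\ge r_B$ entrywise where $r_A(i,j)=\sum_{k\le i,l\le j}a_{kl}$; join = ASM with entrywise-minimum corner sums; permutations identified with permutation matrices (1 at $(i,w(i))$). $[\lambda,d]_g\in\mathcal S_n$: $u(t)=\lambda_{d-t+1}+t$ for $t\le d$, $u(d+1)<\cdots<u(n)$ (identity if $\lambda=\emptyset$). $A_{\boldsymbol\lambda,\mathbf d}=\vee\{[\lambda^{(i)},d_i]_g\}$. Prism tableaux (matrix coordinates, row $a$ from top): $\lambda^{(c)}$ occupies cells $\{(a,b):1\le a\le d_c,\ 1\le b\le\lambda^{(c)}_{d_c-a+1}\}$;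 a prism tableau $\mathcal T=(T^{(1)},\ldots,T^{(k)})$ fills each with integers in $\{1,\ldots,d_c\}$ (color $c$) weakly decreasing along rows left to right and strictly decreasing up columns. ${\tt wt}(\mathcal T)=\prod_m x_m^{n_m}$, $n_m$ = number of antidiagonals $\{a+b=s\}$ containing an entry $m$. Minimal: total degree of weight equals the minimum over all prism tableaux for $(\boldsymbol\lambda,\mathbf d)$. Unstable triple: in one antidiagonal, an entry $\ell$ of color $c$, another entry $\ell$ of color $d\ne c$, and an entry $\ell'>\ell$, such that replacing that entry $\ell$ of color $c$ by $\ell'$ gives a prism tableau. ${\tt Prism}(\boldsymbol\lambda,\mathbf d)$: minimal prism tableaux without unstable triples. Square word $Q_{n\times n}=s_n\cdots s_1\ s_{n+1}\cdots s_2\cdots s_{2n-1}\cdots s_n$ (simple transpositions of $\mathcal S_{2n}$), letters identified with cells of the $n\times n$ grid, cell $(i,j)\leftrightarrow s_{i+j-1}$, read rows top to bottom, each row right to left; subwords $P$ ↔ sets of cells; $F_P$ = complement of $P$. $\Delta(Q,A)=\{F_P:\delta(P)\ge A\}$ with $\delta$ the Demazure product ($e_we_s=e_{ws}$ if $\ell(ws)>\ell(w)$, else $e_w$); facets are maximal faces. ${\tt wt}(F_P)=\prod_i x_i^{n_i}$, $n_i$ = number of cells of $P$ in row $i$. $P_{\mathcal T}$ = set of cells $(t,a+b-t)$ over all entries $t$ in cells $(a,b)$ of all components; $\Phi_{\boldsymbol\lambda,\mathbf d}(\mathcal T)=F_{P_{\mathcal T}}\in\Delta_A$. $\mathcal T$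 is a facet prism tableau if $\Phi_{\boldsymbol\lambda,\mathbf d}(\mathcal T)\in F(\Delta_A)$; ${\tt StableFacet}(\boldsymbol\lambda,\mathbf d)$ is the set of facet prism tableaux with no unstable triple. *)

theory Defs
  imports "HOL-Combinatorics.Permutations"
begin

section \<open>Alternating sign matrices\<close>

text \<open>
  A square matrix of size \<open>n\<close> is a function \<open>nat \<Rightarrow> nat \<Rightarrow> int\<close> with rows and columns indexed by
  \<open>1, \<dots>, n\<close>. Matrices of size \<open>n\<close> are normalised to vanish at all other indices, so that equality
  of matrices is equality of functions.
\<close>

type_synonym matrix = "nat \<Rightarrow> nat \<Rightarrow> int"

definition alternating :: "nat \<Rightarrow> (nat \<Rightarrow> int) \<Rightarrow> bool" where
  "alternating n v \<longleftrightarrow>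
     (\<forall>j\<in>{1..n}. \<forall>j'\<in>{1..n}. j < j' \<and> v j \<noteq> 0 \<and> v j' \<noteq> 0 \<and> (\<forall>k. j < k \<and> k < j' \<longrightarrow> v k = 0)
        \<longrightarrow> sgn (v j') = - sgn (v j))"

definition is_asm :: "nat \<Rightarrow> matrix \<Rightarrow> bool" where
  "is_asm n A \<longleftrightarrow>
     (\<forall>i\<in>{1..n}. \<forall>j\<in>{1..n}. A i j \<in> {-1, 0, 1}) \<and>
     (\<forall>i\<in>{1..n}. alternating n (\<lambda>j. A i j)) \<and>
     (\<forall>j\<in>{1..n}. alternating n (\<lambda>i. A i j)) \<and>
     (\<forall>i\<in>{1..n}. (\<Sum>j\<in>{1..n}. A i j) = 1) \<and>
     (\<forall>j\<in>{1..n}. (\<Sum>i\<in>{1..n}. A i j) = 1) \<and>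
     (\<forall>i j. i \<notin> {1..n} \<or> j \<notin> {1..n} \<longrightarrow> A i j = 0)"

definition corner_sum :: "matrix \<Rightarrow> nat \<Rightarrow> nat \<Rightarrow> int" where
  "corner_sum A i j = (\<Sum>k\<in>{1..i}. \<Sum>l\<in>{1..j}. A k l)"

definition asm_le :: "nat \<Rightarrow> matrix \<Rightarrow> matrix \<Rightarrow> bool" where
  "asm_le n A B \<longleftrightarrow> (\<forall>i\<in>{1..n}. \<forall>j\<in>{1..n}. corner_sum A i j \<ge> corner_sum B i j)"

definition asm_join :: "nat \<Rightarrow> matrix set \<Rightarrow> matrix" where
  "asm_join n S = (THE A. is_asm n A \<and>
     (\<forall>i\<in>{1..n}. \<forall>j\<in>{1..n}. corner_sum A i j = Min ((\<lambda>B. corner_sum B i j) ` S)))"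

definition perm_matrix :: "nat \<Rightarrow> (nat \<Rightarrow> nat) \<Rightarrow> matrix" where
  "perm_matrix n w i j = (if i \<in> {1..n} \<and> j \<in> {1..n} \<and> j = w i then 1 else 0)"

text \<open>
  The block sum with an identity matrix: the embedding of matrices of size \<open>n\<close> into those of size
  \<open>m \<ge> n\<close> that extends the usual inclusion of symmetric groups.
\<close>

definition asm_embed :: "nat \<Rightarrow> nat \<Rightarrow> matrix \<Rightarrow> matrix" where
  "asm_embed n m A i j =
     (if i \<in> {1..n} \<and> j \<in> {1..n} then A i j
      else if i = j \<and> n < i \<and> i \<le> m then 1 else 0)"

section \<open>Partitions and Grassmannian permutations\<close>

definition is_partition :: "nat list \<Rightarrow> bool" where
  "is_partition l \<longleftrightarrow> sorted_wrt (\<ge>) l \<and> (\<forall>x\<in>set l. 0 < x)"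

text \<open>The \<open>j\<close>-th part, for \<open>j\<close> starting at 1, with zeros appended after the last positive part.\<close>

definition part :: "nat list \<Rightarrow> nat \<Rightarrow> nat" where
  "part l j = (if j \<in> {1..length l} then l ! (j - 1) else 0)"

text \<open>For the empty partition the conditions below force the identity.\<close>

definition grassmannian :: "nat \<Rightarrow> nat list \<Rightarrow> nat \<Rightarrow> nat \<Rightarrow> nat" where
  "grassmannian n l d = (THE u. u permutes {1..n} \<and>
     (\<forall>t\<in>{1..d}. u t = part l (d - t + 1) + t) \<and>
     strict_mono_on {d + 1..n} u)"

definition asm_of_shapes :: "nat \<Rightarrow> nat list list \<Rightarrow> nat list \<Rightarrow> matrix" where
  "asm_of_shapes n ls ds =
     asm_join n {perm_matrix n (grassmannian n (ls ! c) (ds ! c)) | c. c < length ls}"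

section \<open>Prism tableaux\<close>

text \<open>
  Cells are pairs (row, column), both starting at 1. A tuple of fillings is a function of the
  colour and the cell, where the colour \<open>c < length ls\<close> is a position in the list \<open>ls\<close> of shapes.
  The value 0 marks cells outside the shape and unused colours, so that a prism tableau is
  determined by its entries.
\<close>

type_synonym cell = "nat \<times> nat"
type_synonym filling = "nat \<Rightarrow> cell \<Rightarrow> nat"

definition shape :: "nat list \<Rightarrow> nat \<Rightarrow> cell set" where
  "shape l d = {(a, b). 1 \<le> a \<and> a \<le> d \<and> 1 \<le> b \<and> b \<le> part l (d - a + 1)}"

definition is_tableau :: "nat list \<Rightarrow> nat \<Rightarrow> (cell \<Rightarrow> nat) \<Rightarrow> bool" where
  "is_tableau l d X \<longleftrightarrow>
     (\<forall>p\<in>shape l d. X p \<in> {1..d}) \<and>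
     (\<forall>p. p \<notin> shape l d \<longrightarrow> X p = 0) \<and>
     (\<forall>a b b'. (a, b) \<in> shape l d \<and> (a, b') \<in> shape l d \<and> b < b' \<longrightarrow> X (a, b) \<ge> X (a, b')) \<and>
     (\<forall>a a' b. (a, b) \<in> shape l d \<and> (a', b) \<in> shape l d \<and> a < a' \<longrightarrow> X (a, b) < X (a', b))"

definition prism_tableaux :: "nat list list \<Rightarrow> nat list \<Rightarrow> filling set" where
  "prism_tableaux ls ds =
     {T. (\<forall>c<length ls. is_tableau (ls ! c) (ds ! c) (T c)) \<and>
         (\<forall>c p. length ls \<le> c \<longrightarrow> T c p = 0)}"

definition has_entry :: "nat list list \<Rightarrow> nat list \<Rightarrow> filling \<Rightarrow> nat \<Rightarrow> cell \<Rightarrow> nat \<Rightarrow> bool" where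
  "has_entry ls ds T c p m \<longleftrightarrow> c < length ls \<and> p \<in> shape (ls ! c) (ds ! c) \<and> T c p = m"

definition antidiag :: "cell \<Rightarrow> nat" where
  "antidiag p = fst p + snd p"

text \<open>Monomials in \<open>x\<^sub>1, x\<^sub>2, \<dots>\<close> are represented by their exponents \<open>nat \<Rightarrow> nat\<close>.\<close>

definition prism_weight :: "nat list list \<Rightarrow> nat list \<Rightarrow> filling \<Rightarrow> nat \<Rightarrow> nat" where
  "prism_weight ls ds T m = card {s. \<exists>c p. has_entry ls ds T c p m \<and> antidiag p = s}"

definition total_degree :: "(nat \<Rightarrow> nat) \<Rightarrow> nat" where
  "total_degree e = (\<Sum>m\<in>{m. e m \<noteq> 0}. e m)"

definition minimal_prism :: "nat list list \<Rightarrow> nat list \<Rightarrow> filling \<Rightarrow> bool" where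
  "minimal_prism ls ds T \<longleftrightarrow> T \<in> prism_tableaux ls ds \<and>
     (\<forall>S\<in>prism_tableaux ls ds.
        total_degree (prism_weight ls ds T) \<le> total_degree (prism_weight ls ds S))"

definition has_unstable_triple :: "nat list list \<Rightarrow> nat list \<Rightarrow> filling \<Rightarrow> bool" where
  "has_unstable_triple ls ds T \<longleftrightarrow>
     (\<exists>c c' c'' p p' p'' m m'.
        has_entry ls ds T c p m \<and> has_entry ls ds T c' p' m \<and> has_entry ls ds T c'' p'' m' \<and>
        antidiag p = antidiag p' \<and> antidiag p = antidiag p'' \<and>
        c' \<noteq> c \<and> m < m' \<and>
        T(c := (T c)(p := m')) \<in> prism_tableaux ls ds)"

definition Prism :: "nat list list \<Rightarrow> nat list \<Rightarrow> filling set" where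
  "Prism ls ds = {T. minimal_prism ls ds T \<and> \<not> has_unstable_triple ls ds T}"

section \<open>Subword complexes of the square word\<close>

definition grid :: "nat \<Rightarrow> cell set" where
  "grid n = {1..n} \<times> {1..n}"

text \<open>
  The square word, as the list of its cells in reading order: rows from top to bottom, each row
  from right to left. The letter at \<open>(i, j)\<close> is the transposition of \<open>i + j - 1\<close> and \<open>i + j\<close>.
\<close>

definition square_word :: "nat \<Rightarrow> cell list" where
  "square_word n = [(i, j). i \<leftarrow> [1..<n + 1], j \<leftarrow> rev [1..<n + 1]]"

definition simple_transp :: "nat \<Rightarrow> nat \<Rightarrow> nat" where
  "simple_transp i = Transposition.transpose i (i + 1)"

definition letter :: "cell \<Rightarrow> nat \<Rightarrow> nat" where
  "letter p = simple_transp (fst p + snd p - 1)"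

definition coxeter_length :: "(nat \<Rightarrow> nat) \<Rightarrow> nat" where
  "coxeter_length w = card {(i, j). i < j \<and> w j < w i}"

definition demazure_mult :: "(nat \<Rightarrow> nat) \<Rightarrow> (nat \<Rightarrow> nat) \<Rightarrow> (nat \<Rightarrow> nat)" where
  "demazure_mult w s = (if coxeter_length (w \<circ> s) > coxeter_length w then w \<circ> s else w)"

definition demazure_product :: "(nat \<Rightarrow> nat) list \<Rightarrow> (nat \<Rightarrow> nat)" where
  "demazure_product ss = foldl demazure_mult id ss"

definition subword :: "nat \<Rightarrow> cell set \<Rightarrow> (nat \<Rightarrow> nat) list" where
  "subword n P = map letter (filter (\<lambda>p. p \<in> P) (square_word n))"

definition face_of :: "nat \<Rightarrow> cell set \<Rightarrow> cell set" where
  "face_of n P = grid n - P"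

text \<open>
  The Demazure product of a subword lies in the symmetric group on \<open>{1..2 * n}\<close>, so \<open>A\<close>, of size
  \<open>n\<close>, is compared with it after embedding into size \<open>2 * n\<close>.
\<close>

definition subword_complex :: "nat \<Rightarrow> matrix \<Rightarrow> cell set set" where
  "subword_complex n A = {face_of n P | P. P \<subseteq> grid n \<and>
     asm_le (2 * n) (asm_embed n (2 * n) A)
       (perm_matrix (2 * n) (demazure_product (subword n P)))}"

definition facets :: "'a set set \<Rightarrow> 'a set set" where
  "facets D = {F \<in> D. \<forall>G\<in>D. F \<subseteq> G \<longrightarrow> G = F}"

text \<open>A face \<open>F\<close> has dimension \<open>card F - 1\<close>.\<close>

definition max_dim_faces :: "'a set set \<Rightarrow> 'a set set" where
  "max_dim_faces D = {F \<in> D. \<forall>G\<in>D. card G \<le> card F}"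

text \<open>Recall that \<open>P = grid n - F\<close> when \<open>F = face_of n P\<close> with \<open>P \<subseteq> grid n\<close>.\<close>

definition face_weight :: "nat \<Rightarrow> cell set \<Rightarrow> nat \<Rightarrow> nat" where
  "face_weight n F i = card {j. (i, j) \<in> grid n - F}"

section \<open>From prism tableaux to faces\<close>

text \<open>
  An entry \<open>t\<close> in row \<open>a\<close> of a prism tableau satisfies \<open>t \<le> a\<close>, so the subtraction below is not
  truncated.
\<close>

definition tableau_cells :: "nat list list \<Rightarrow> nat list \<Rightarrow> filling \<Rightarrow> cell set" where
  "tableau_cells ls ds T = {(t, a + b - t) | t a b c. has_entry ls ds T c (a, b) t}"

definition Phi :: "nat \<Rightarrow> nat list list \<Rightarrow> nat list \<Rightarrow> filling \<Rightarrow> cell set" where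
  "Phi n ls ds T = face_of n (tableau_cells ls ds T)"

definition StableFacet :: "nat \<Rightarrow> nat list list \<Rightarrow> nat list \<Rightarrow> filling set" where
  "StableFacet n ls ds = {T \<in> prism_tableaux ls ds.
     Phi n ls ds T \<in> facets (subword_complex n (asm_of_shapes n ls ds)) \<and>
     \<not> has_unstable_triple ls ds T}"

end

theory Submission
  imports Defs
begin

text \<open>
  Since a Grassmannian permutation has a single descent \<open>d\<close>, the condition that a Demazure product
  \<open>\<delta>(P)\<close> lies above it only concerns the set of the first \<open>d\<close> values of \<open>\<delta>(P)\<close>. Reading the word
  backwards, this set evolves like \<open>d\<close> beads on a line, each letter \<open>k\<close> moving a bead from \<open>k\<close> to
  \<open>k + 1\<close> if possible. Recording in which row each step of each bead happens gives a tableau whose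
  cells lie in \<open>P\<close>, and conversely any tableau with cells in \<open>P\<close> forces the beads to move far enough.
  So the complements of the faces of \<open>\<Delta>\<^sub>A\<close> are the sets that contain \<open>P\<^sub>T\<close> for some prism
  tableau \<open>T\<close>, and facets correspond to the minimal sets \<open>P\<^sub>T\<close>.

  The prism tableaux with cells in \<open>P\<close> are closed under pointwise maxima. The largest one has no
  unstable triple, because the replacement in such a triple would not leave \<open>P\<close>. If \<open>P\<^sub>T = P\<close> is
  minimal and \<open>T\<close> is not the largest, some entry can be raised to its maximal value; by
  minimality the old cell must still be covered, necessarily by another colour, and this is an
  unstable triple.
\<close>

section \<open>Corner sums\<close>

text \<open>The condition \<open>\<delta>(P) \<ge> A\<close> splits over the colours because the
  corner sums of a join are minima. As \<open>asm_join\<close> is a definite description, this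
  requires an alternating sign matrix with these minima; it exists because the conditions describing
  corner sums survive minima. The Demazure product multiplies on the right and so permutes
  positions, while its set of first \<open>d\<close> values changes under multiplication on the
  left. The two actions commute, which allows a letter to be split off at the front of the word. The
  inequalities of a tableau come from the reading order. Backwards, the rows are read from bottom to
  top and each row from left to right. A bead can therefore make several consecutive steps within
  one row, and its later steps lie in the same row or higher: rows decrease weakly. Bead
  \<open>a\<close> can enter position \<open>a + b\<close> only after bead \<open>a + 1\<close> has
  left it. In any single row the letter for that departure stands further right and is reached too
  late, so the departure belongs to a strictly lower row: columns are strict.\<close>

lemma corner_sum_perm_matrix:
  assumes "w permutes {1..n}" "i \<le> n" "j \<le> n"
  shows "corner_sum (perm_matrix n w) i j = int (card {t\<in>{1..i}. w t \<le> j})"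
proof -
  have "(\<Sum>l\<in>{1..j}. perm_matrix n w t l) = (if w t \<le> j then 1 else 0)" if "t \<in> {1..i}" for t
  proof -
    have "t \<in> {1..n}"
      using that assms by auto
    moreover have "w t \<in> {1..n}"
      using permutes_in_image[OF assms(1)] \<open>t \<in> {1..n}\<close> by blast
    ultimately have "(\<Sum>l\<in>{1..j}. perm_matrix n w t l) = (\<Sum>l\<in>{1..j}. if l = w t then 1 else 0)"
      using assms by (intro sum.cong) (auto simp: perm_matrix_def)
    also have "\<dots> = (if w t \<le> j then 1 else 0)"
      using \<open>w t \<in> {1..n}\<close> by auto
    finally show ?thesis .
  qed
  then have "corner_sum (perm_matrix n w) i j = (\<Sum>t\<in>{1..i}. if w t \<le> j then 1 else 0)"
    unfolding corner_sum_def by (intro sum.cong) auto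
  also have "\<dots> = int (card {t\<in>{1..i}. w t \<le> j})"
    by (simp add: sum.If_cases Int_def)
  finally show ?thesis .
qed

text \<open>The classical description of the corner sums of alternating sign matrices. A difference
  of adjacent values is a partial row or column sum, and alternation with total 1 keeps such sums in
  {0, 1}.\<close>

definition corner_function :: "nat \<Rightarrow> (nat \<Rightarrow> nat \<Rightarrow> int) \<Rightarrow> bool" where
  "corner_function n R \<longleftrightarrow>
     (\<forall>i\<le>n. R i 0 = 0 \<and> R 0 i = 0 \<and> R i n = int i \<and> R n i = int i) \<and>
     (\<forall>i<n. \<forall>j\<le>n. R (Suc i) j - R i j \<in> {0, 1} \<and> R j (Suc i) - R j i \<in> {0, 1})"

lemma card_permutes_le:
  assumes "w permutes {1..n}" "i \<le> n"
  shows "card {t\<in>{1..n}. w t \<le> i} = i"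
proof -
  have "w ` {t\<in>{1..n}. w t \<le> i} = {1..i}"
  proof
    show "w ` {t\<in>{1..n}. w t \<le> i} \<subseteq> {1..i}"
    proof (rule image_subsetI)
      fix t assume "t \<in> {t\<in>{1..n}. w t \<le> i}"
      then show "w t \<in> {1..i}"
        using permutes_in_image[OF assms(1), of t] by simp
    qed
    show "{1..i} \<subseteq> w ` {t\<in>{1..n}. w t \<le> i}"
    proof
      fix x assume "x \<in> {1..i}"
      then have "x \<in> w ` {1..n}"
        using assms by (simp add: permutes_image)
      then show "x \<in> w ` {t\<in>{1..n}. w t \<le> i}"
        using \<open>x \<in> {1..i}\<close> by auto
    qed
  qed
  moreover have "inj_on w {t\<in>{1..n}. w t \<le> i}"
    using permutes_inj[OF assms(1)] by (rule inj_on_subset) simp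
  ultimately show ?thesis
    using card_image[of w "{t\<in>{1..n}. w t \<le> i}"] by simp
qed

lemma corner_function_perm_matrix:
  assumes w: "w permutes {1..n}"
  shows "corner_function n (corner_sum (perm_matrix n w))"
proof -
  have pos: "1 \<le> w t" "w t \<le> n" if "1 \<le> t" "t \<le> n" for t
    using permutes_in_image[OF w, of t] that by auto
  have "{t\<in>{1..i}. w t \<le> n} = {1..i}" if "i \<le> n" for i
    using that pos by auto
  then have border: "card {t\<in>{1..i}. w t \<le> n} = i" if "i \<le> n" for i
    using that by simp
  have row: "{t\<in>{1..Suc i}. w t \<le> j} = {t\<in>{1..i}. w t \<le> j} \<union> (if w (Suc i) \<le> j then {Suc i} else {})"
    for i j by (auto simp: le_Suc_eq)
  have col: "{t\<in>{1..i}. w t \<le> Suc j} = {t\<in>{1..i}. w t \<le> j} \<union> {t\<in>{1..i}. w t = Suc j}" for i j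
    by auto
  have one: "card {t\<in>{1..i}. w t = Suc j} \<le> 1" for i j
    using permutes_inj[OF w] by (simp add: card_le_Suc0_iff_eq) (metis injD)
  have col': "card {t\<in>{1..i}. w t \<le> Suc j} = card {t\<in>{1..i}. w t \<le> j} + card {t\<in>{1..i}. w t = Suc j}" for i j
    unfolding col by (rule card_Un_disjoint) auto
  have row': "card {t\<in>{1..Suc i}. w t \<le> j} = card {t\<in>{1..i}. w t \<le> j} + (if w (Suc i) \<le> j then 1 else 0)" for i j
    unfolding row by (subst card_Un_disjoint) auto
  have step: "card {t\<in>{1..i}. w t \<le> Suc j} = card {t\<in>{1..i}. w t \<le> j}
      \<or> card {t\<in>{1..i}. w t \<le> Suc j} = Suc (card {t\<in>{1..i}. w t \<le> j})"
    "card {t\<in>{1..Suc i}. w t \<le> j} = card {t\<in>{1..i}. w t \<le> j}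
      \<or> card {t\<in>{1..Suc i}. w t \<le> j} = Suc (card {t\<in>{1..i}. w t \<le> j})" for i j
    using one[of i j] col'[of i j] row'[of i j] by (linarith, simp split: if_splits)
  note cs = corner_sum_perm_matrix[OF w]
  show ?thesis
    unfolding corner_function_def
  proof (intro conjI allI impI)
    fix i assume i: "i \<le> n"
    show "corner_sum (perm_matrix n w) i 0 = 0" "corner_sum (perm_matrix n w) 0 i = 0"
      by (simp_all add: corner_sum_def)
    show "corner_sum (perm_matrix n w) i n = int i" "corner_sum (perm_matrix n w) n i = int i"
      by (simp_all only: cs i order_refl border card_permutes_le[OF w])
  next
    fix i j assume "i < n" "j \<le> n"
    then have "Suc i \<le> n" "i \<le> n" by auto
    then show "corner_sum (perm_matrix n w) (Suc i) j - corner_sum (perm_matrix n w) i j \<in> {0, 1}"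
      "corner_sum (perm_matrix n w) j (Suc i) - corner_sum (perm_matrix n w) j i \<in> {0, 1}"
      using step(1)[of j i] step(2)[of i j] by (auto simp only: cs \<open>j \<le> n\<close> insert_iff)
  qed
qed

section \<open>From corner functions to alternating sign matrices and their joins\<close>

lemma sgn_of_unit_steps:
  fixes a x y :: int
  assumes "a \<in> {0, 1}" "a + x \<in> {0, 1}" "a + x + y \<in> {0, 1}" "x \<noteq> 0" "y \<noteq> 0"
  shows "sgn y = - sgn x"
  using assms by auto

text \<open>The partial sums walk inside {0, 1}, where two successive proper steps must go in
  opposite directions. Between consecutive nonzero entries the walk stands still.\<close>

lemma alternating_if_partial_sums:
  assumes "\<And>j. j \<le> n \<Longrightarrow> (\<Sum>l\<in>{1..j}. v l) \<in> {0, 1}"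
  shows "alternating n v"
  unfolding alternating_def
proof (intro ballI impI)
  fix j j' assume j: "j \<in> {1..n}" and j': "j' \<in> {1..n}"
    and *: "j < j' \<and> v j \<noteq> 0 \<and> v j' \<noteq> 0 \<and> (\<forall>k. j < k \<and> k < j' \<longrightarrow> v k = 0)"
  define h where "h = (\<lambda>j. \<Sum>l\<in>{1..j}. v l)"
  have step: "h k = h (k - 1) + v k" if "1 \<le> k" for k
    using that unfolding h_def by (cases k) simp_all
  have const: "h k = h j" if "j \<le> k" "k < j'" for k
    using that
  proof (induction k rule: dec_induct)
    case (step k)
    then have "v (Suc k) = 0"
      using * by auto
    then show ?case
      using step by (simp add: h_def)
  qed simp
  have "h (j' - 1) = h j"
    by (rule const) (use * in auto)
  then have "h j' = h (j - 1) + v j + v j'" "h j = h (j - 1) + v j"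
    using step[of j] step[of j'] j j' by (simp_all del: One_nat_def)
  moreover have le: "j' \<le> n" "j \<le> n" "j - 1 \<le> n"
    using j j' by auto
  have "h j' \<in> {0, 1}" "h j \<in> {0, 1}" "h (j - 1) \<in> {0, 1}"
    unfolding h_def by (rule assms[OF le(1)] assms[OF le(2)] assms[OF le(3)])+
  ultimately show "sgn (v j') = - sgn (v j)"
    using * by (intro sgn_of_unit_steps[of "h (j - 1)"]) simp_all
qed

text \<open>The matrix is the mixed second difference of \<open>R\<close>. Its partial row and
  column sums telescope to single differences of \<open>R\<close>, from which the range of the
  entries, the alternation and the totals follow.\<close>

lemma asm_of_corner_function:
  assumes R: "corner_function n R"
  shows "\<exists>A. is_asm n A \<and> (\<forall>i\<le>n. \<forall>j\<le>n. corner_sum A i j = R i j)"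
proof -
  define A where "A i j = (if i \<in> {1..n} \<and> j \<in> {1..n}
    then R i j - R (i - 1) j - R i (j - 1) + R (i - 1) (j - 1) else 0)" for i j
  have border: "R i 0 = 0" "R 0 i = 0" "R i n = int i" "R n i = int i" if "i \<le> n" for i
    using R that by (auto simp: corner_function_def)
  have stepr: "R i j - R (i - 1) j \<in> {0, 1}" if "i \<in> {1..n}" "j \<le> n" for i j
    using R that by (cases i) (auto simp: corner_function_def)
  have stepc: "R i j - R i (j - 1) \<in> {0, 1}" if "j \<in> {1..n}" "i \<le> n" for i j
    using R that by (cases j) (auto simp: corner_function_def)
  have row: "(\<Sum>l\<in>{1..j}. A i l) = R i j - R (i - 1) j" if "i \<in> {1..n}" "j \<le> n" for i j
    using that(2)
  proof (induction j)
    case 0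
    have "i - 1 \<le> n" "i \<le> n" using that by auto
    then show ?case by (simp add: border)
  next
    case (Suc j)
    then show ?case using that by (simp add: A_def)
  qed
  have col: "(\<Sum>k\<in>{1..i}. A k j) = R i j - R i (j - 1)" if "j \<in> {1..n}" "i \<le> n" for i j
    using that(2)
  proof (induction i)
    case 0
    have "j - 1 \<le> n" "j \<le> n" using that by auto
    then show ?case by (simp add: border)
  next
    case (Suc i)
    then show ?case using that by (simp add: A_def)
  qed
  have "corner_sum A i j = R i j" if "i \<le> n" "j \<le> n" for i j
    using that(1)
  proof (induction i)
    case 0
    then show ?case using that by (simp add: corner_sum_def border)
  next
    case (Suc i)
    then show ?case using row[of "Suc i" j] that by (simp add: corner_sum_def)
  qed
  moreover have "is_asm n A"
    unfolding is_asm_def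
  proof (intro conjI ballI allI impI)
    fix i j assume i: "i \<in> {1..n}" and j: "j \<in> {1..n}"
    have "R i j - R (i - 1) j \<in> {0, 1}" "R i (j - 1) - R (i - 1) (j - 1) \<in> {0, 1}"
      using stepr[OF i, of j] stepr[OF i, of "j - 1"] j by auto
    then show "A i j \<in> {-1, 0, 1}"
      using i j by (auto simp: A_def)
  next
    fix i assume i: "i \<in> {1..n}"
    show "alternating n (\<lambda>j. A i j)"
      using row[OF i] stepr[OF i] by (intro alternating_if_partial_sums) simp
    show "alternating n (\<lambda>j. A j i)"
      using col[OF i] stepc[OF i] by (intro alternating_if_partial_sums) simp
    have "i - 1 \<le> n" "i \<le> n" using i by auto
    then show "(\<Sum>j\<in>{1..n}. A i j) = 1" "(\<Sum>j\<in>{1..n}. A j i) = 1"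
      using i by (simp_all only: row col border order_refl) auto
  qed (auto simp: A_def)
  ultimately show ?thesis by blast
qed

lemma asm_entry_eq_corner_sum:
  assumes "1 \<le> i" "1 \<le> j"
  shows "A i j = corner_sum A i j - corner_sum A (i - 1) j - corner_sum A i (j - 1)
    + corner_sum A (i - 1) (j - 1)"
proof -
  obtain i' j' where "i = Suc i'" "j = Suc j'"
    using assms by (metis One_nat_def Suc_le_D)
  then show ?thesis by (simp add: corner_sum_def sum.distrib)
qed

text \<open>Supplies the uniqueness behind the definite description in \<open>asm_join\<close>: the
  entries are mixed second differences of the corner sums, and those with an index 0 vanish.\<close>

lemma asm_eqI_corner_sum:
  assumes "is_asm n A" "is_asm n B"
    and eq: "\<And>i j. i \<in> {1..n} \<Longrightarrow> j \<in> {1..n} \<Longrightarrow> corner_sum A i j = corner_sum B i j"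
  shows "A = B"
proof (intro ext)
  fix i j
  have eq': "corner_sum A i j = corner_sum B i j" if "i \<le> n" "j \<le> n" for i j
  proof (cases "i = 0 \<or> j = 0")
    case True
    then show ?thesis by (auto simp: corner_sum_def)
  next
    case False
    then show ?thesis using eq[of i j] that by simp
  qed
  show "A i j = B i j"
  proof (cases "i \<in> {1..n} \<and> j \<in> {1..n}")
    case True
    then have "i \<le> n" "i - 1 \<le> n" "j \<le> n" "j - 1 \<le> n" "1 \<le> i" "1 \<le> j"
      by auto
    then show ?thesis
      using asm_entry_eq_corner_sum[of i j A] asm_entry_eq_corner_sum[of i j B] by (simp only: eq')
  next
    case False
    then show ?thesis
      using assms(1,2) unfolding is_asm_def by metis
  qed
qed

text \<open>At a minimiser of \<open>f\<close> the function \<open>g\<close> is larger by at most 1,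
  which bounds the difference from above; at a minimiser of \<open>g\<close> the function
  \<open>f\<close> is no larger, which bounds it from below.\<close>

lemma Min_image_step:
  fixes f g :: "'a \<Rightarrow> int"
  assumes "finite S" "S \<noteq> {}" "\<And>x. x \<in> S \<Longrightarrow> g x - f x \<in> {0, 1}"
  shows "Min (g ` S) - Min (f ` S) \<in> {0, 1}"
proof -
  obtain x where x: "x \<in> S" "Min (f ` S) = f x"
    using assms(1,2) by (metis (mono_tags, lifting) Min_in finite_imageI image_iff image_is_empty)
  obtain y where y: "y \<in> S" "Min (g ` S) = g y"
    using assms(1,2) by (metis (mono_tags, lifting) Min_in finite_imageI image_iff image_is_empty)
  have "g y \<le> g x" "f x \<le> f y"
    using x y assms(1) by (metis Min_le finite_imageI image_eqI)+
  then show ?thesis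
    using assms(3)[OF x(1)] assms(3)[OF y(1)] x y by auto
qed

lemma asm_join_corner_sum:
  assumes S: "finite S" "S \<noteq> {}" "\<And>B. B \<in> S \<Longrightarrow> corner_function n (corner_sum B)"
    and ij: "i \<le> n" "j \<le> n"
  shows "corner_sum (asm_join n S) i j = Min ((\<lambda>B. corner_sum B i j) ` S)"
proof -
  let ?R = "\<lambda>i j. Min ((\<lambda>B. corner_sum B i j) ` S)"
  have border: "?R i j = z" if "\<And>B. B \<in> S \<Longrightarrow> corner_sum B i j = z" for i j z
  proof -
    have "(\<lambda>B. corner_sum B i j) ` S = {z}"
      using that S(2) by auto
    then show ?thesis by simp
  qed
  have "corner_function n ?R"
    unfolding corner_function_def
  proof (intro conjI allI impI)
    fix i assume "i \<le> n"
    then show "?R i 0 = 0" "?R 0 i = 0" "?R i n = int i" "?R n i = int i"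
      using S(3) by (auto simp only: corner_function_def intro!: border)
  next
    fix i j assume "i < n" "j \<le> n"
    show "?R (Suc i) j - ?R i j \<in> {0, 1}" "?R j (Suc i) - ?R j i \<in> {0, 1}"
      by (rule Min_image_step[OF S(1,2)]; use S(3) \<open>i < n\<close> \<open>j \<le> n\<close> in \<open>auto simp only: corner_function_def\<close>)+
  qed
  then obtain A where A: "is_asm n A" "\<And>i j. i \<le> n \<Longrightarrow> j \<le> n \<Longrightarrow> corner_sum A i j = ?R i j"
    using asm_of_corner_function by blast
  have "asm_join n S = A"
    unfolding asm_join_def
  proof (rule the_equality)
    show "is_asm n A \<and> (\<forall>i\<in>{1..n}. \<forall>j\<in>{1..n}. corner_sum A i j = ?R i j)"
      using A by auto
  next
    fix B assume B: "is_asm n B \<and> (\<forall>i\<in>{1..n}. \<forall>j\<in>{1..n}. corner_sum B i j = ?R i j)"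
    show "B = A"
      using A B by (intro asm_eqI_corner_sum[of n]) auto
  qed
  then show ?thesis using A ij by simp
qed

section \<open>Comparison after embedding into a larger size\<close>

lemma corner_sum_asm_embed:
  assumes "i \<le> m" "j \<le> m"
  shows "corner_sum (asm_embed n m A) i j = corner_sum A (min i n) (min j n) + int (min i j - n)"
proof -
  have row: "(\<Sum>l\<in>{1..j}. asm_embed n m A k l) =
      (if k \<le> n then \<Sum>l\<in>{1..min j n}. A k l else 0) + (if n < k \<and> k \<le> j then 1 else 0)"
    if "k \<in> {1..i}" for k
  proof (cases "k \<le> n")
    case True
    have "(\<Sum>l\<in>{1..j}. asm_embed n m A k l) = (\<Sum>l\<in>{1..min j n}. asm_embed n m A k l)"
      using True that by (intro sum.mono_neutral_right) (auto simp: asm_embed_def)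
    also have "\<dots> = (\<Sum>l\<in>{1..min j n}. A k l)"
      using True that by (intro sum.cong) (auto simp: asm_embed_def)
    finally show ?thesis using True by simp
  next
    case False
    then have "(\<Sum>l\<in>{1..j}. asm_embed n m A k l) = (\<Sum>l\<in>{1..j}. if l = k then 1 else 0)"
      using that assms by (intro sum.cong) (auto simp: asm_embed_def)
    then show ?thesis using False by auto
  qed
  have "(\<Sum>k\<in>{1..i}. if k \<le> n then \<Sum>l\<in>{1..min j n}. A k l else 0)
      = (\<Sum>k\<in>{1..min i n}. if k \<le> n then \<Sum>l\<in>{1..min j n}. A k l else 0)"
    by (intro sum.mono_neutral_right) auto
  also have "\<dots> = corner_sum A (min i n) (min j n)"
    unfolding corner_sum_def by (intro sum.cong) auto
  finally have 1: "(\<Sum>k\<in>{1..i}. if k \<le> n then \<Sum>l\<in>{1..min j n}. A k l else 0)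
    = corner_sum A (min i n) (min j n)" .
  \<comment> \<open>The ones on the added diagonal. Their number is a truncated difference, hence 0
    unless both indices exceed \<open>n\<close>.\<close>
  have "(\<Sum>k\<in>{1..i}. if n < k \<and> k \<le> j then 1 else 0::int) = int (card {k\<in>{1..i}. n < k \<and> k \<le> j})"
    by (simp add: sum.If_cases Int_def)
  also have "{k\<in>{1..i}. n < k \<and> k \<le> j} = {n<..min i j}"
    by auto
  finally have 2: "(\<Sum>k\<in>{1..i}. if n < k \<and> k \<le> j then 1 else 0::int) = int (min i j - n)"
    by simp
  have "corner_sum (asm_embed n m A) i j = (\<Sum>k\<in>{1..i}.
      (if k \<le> n then \<Sum>l\<in>{1..min j n}. A k l else 0) + (if n < k \<and> k \<le> j then 1 else 0))"
    unfolding corner_sum_def by (rule sum.cong[OF refl row])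
  then show ?thesis
    by (simp only: sum.distrib 1 2)
qed

lemma card_le_min_permutes:
  assumes "w permutes {1..m}" "i \<le> m" "j \<le> m"
  shows "card {t\<in>{1..i}. w t \<le> j} \<le> min i j"
proof -
  have "card {t\<in>{1..i}. w t \<le> j} \<le> card {1..i}"
    by (intro card_mono) auto
  moreover have "card {t\<in>{1..i}. w t \<le> j} \<le> card {t\<in>{1..m}. w t \<le> j}"
    using assms(2) by (intro card_mono) auto
  ultimately show ?thesis
    using card_permutes_le[OF assms(1,3)] by simp
qed

text \<open>Outside the corner of size \<open>n\<close> the embedded matrix has corner sum
  \<open>min i j\<close>, the largest value that a permutation can have there, so only the corner
  imposes conditions.\<close>

lemma asm_le_embed_perm_matrix:
  assumes w: "w permutes {1..m}" and "n \<le> m"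
    and border: "\<And>i. i \<le> n \<Longrightarrow> corner_sum A i n = int i \<and> corner_sum A n i = int i"
  shows "asm_le m (asm_embed n m A) (perm_matrix m w) \<longleftrightarrow>
    (\<forall>i\<in>{1..n}. \<forall>j\<in>{1..n}. int (card {t\<in>{1..i}. w t \<le> j}) \<le> corner_sum A i j)"
proof -
  have "int (card {t\<in>{1..i}. w t \<le> j}) \<le> corner_sum (asm_embed n m A) i j"
    if "i \<in> {1..m}" "j \<in> {1..m}" "i \<notin> {1..n} \<or> j \<notin> {1..n}" for i j
  proof -
    have "corner_sum A (min i n) (min j n) + int (min i j - n) = int (min i j)"
      using that border[of "min i n"] border[of "min j n"] by (auto simp: min_def)
    then show ?thesis
      using card_le_min_permutes[OF w, of i j] that by (simp add: corner_sum_asm_embed)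
  qed
  moreover have "corner_sum (asm_embed n m A) i j = corner_sum A i j"
    if "i \<in> {1..n}" "j \<in> {1..n}" for i j
    using that assms(2) by (simp add: corner_sum_asm_embed min_def)
  moreover have "corner_sum (perm_matrix m w) i j = int (card {t\<in>{1..i}. w t \<le> j})"
    if "i \<in> {1..m}" "j \<in> {1..m}" for i j
    using that corner_sum_perm_matrix[OF w] by simp
  moreover have "{1..n} \<subseteq> {1..m}"
    using assms(2) by auto
  ultimately have "corner_sum (perm_matrix m w) i j \<le> corner_sum (asm_embed n m A) i j
      \<longleftrightarrow> (i \<in> {1..n} \<longrightarrow> j \<in> {1..n} \<longrightarrow> int (card {t\<in>{1..i}. w t \<le> j}) \<le> corner_sum A i j)"
    if "i \<in> {1..m}" "j \<in> {1..m}" for i j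
    using that by (cases "i \<in> {1..n} \<and> j \<in> {1..n}") (simp_all only:, auto)
  then show ?thesis
    using \<open>{1..n} \<subseteq> {1..m}\<close> unfolding asm_le_def by blast
qed

section \<open>Grassmannian permutations in Bruhat order\<close>

lemma downclosed_eq_interval:
  fixes A :: "nat set"
  assumes "A \<subseteq> {a<..b}" "\<And>t. t \<in> A \<Longrightarrow> {a<..t} \<subseteq> A"
  shows "A = {a<..a + card A}"
proof (cases "A = {}")
  case False
  have "finite A"
    using assms(1) finite_subset by blast
  then have "A = {a<..Max A}"
    using assms False by (intro equalityI) (auto intro: Max_ge)
  then have "card A = Max A - a"
    by (metis card_greaterThanAtMost)
  moreover have "a < Max A"
    using Max_in[OF \<open>finite A\<close> False] assms(1) by auto
  ultimately show ?thesis
    using \<open>A = {a<..Max A}\<close> by simp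
qed simp

text \<open>The solutions of \<open>f t \<le> j\<close> form an initial segment of the interval, and
  counting up to \<open>i\<close> merely truncates it.\<close>

lemma card_initial_mono:
  fixes f :: "nat \<Rightarrow> nat"
  assumes mono: "strict_mono_on {a<..b} f" and i: "a \<le> i" "i \<le> b"
  shows "card {t\<in>{a<..i}. f t \<le> j} = min (i - a) (card {t\<in>{a<..b}. f t \<le> j})"
proof -
  let ?A = "{t\<in>{a<..b}. f t \<le> j}"
  have mono': "f s \<le> f t" if "s \<in> {a<..b}" "t \<in> {a<..b}" "s \<le> t" for s t
    using strict_mono_onD[OF mono, of s t] that by (cases "s = t") auto
  define K where "K = card ?A"
  have "{a<..t} \<subseteq> ?A" if "t \<in> ?A" for t
  proof
    fix s assume "s \<in> {a<..t}"
    then have "f s \<le> f t" "s \<in> {a<..b}"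
      using that mono'[of s t] by auto
    then show "s \<in> ?A"
      using that by simp
  qed
  then have "?A = {a<..a + K}"
    unfolding K_def by (intro downclosed_eq_interval[where b = b]) blast+
  moreover have "{t\<in>{a<..i}. f t \<le> j} = {a<..i} \<inter> ?A"
    using i by auto
  ultimately have "{t\<in>{a<..i}. f t \<le> j} = {a<..i} \<inter> {a<..a + K}"
    by simp
  also have "\<dots> = {a<..min i (a + K)}"
    by auto
  finally have "card {t\<in>{a<..i}. f t \<le> j} = min i (a + K) - a"
    by simp
  then show ?thesis
    using i unfolding K_def[symmetric] by simp
qed

section \<open>Existence and uniqueness of Grassmannian permutations\<close>

lemma strict_mono_on_eqI:
  fixes u v :: "nat \<Rightarrow> nat"
  assumes "strict_mono_on {a<..b} u" "strict_mono_on {a<..b} v" "u ` {a<..b} = v ` {a<..b}"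
    and "t \<in> {a<..b}"
  shows "u t = v t"
  using assms(4)
proof (induction t rule: less_induct)
  case (less t)
  \<comment> \<open>The value \<open>g t\<close> is taken by \<open>f\<close> somewhere, but not
    before \<open>t\<close>, where \<open>f\<close> and \<open>g\<close> agree and \<open>g\<close>
    is smaller. The claim is stated for general \<open>f\<close> and \<open>g\<close> so that it
    applies in both directions.\<close>
  have "f t \<le> g t" if f: "strict_mono_on {a<..b} f" and g: "strict_mono_on {a<..b} g"
    and img: "g ` {a<..b} = f ` {a<..b}" and IH: "\<And>s. s < t \<Longrightarrow> s \<in> {a<..b} \<Longrightarrow> f s = g s" for f g :: "nat \<Rightarrow> nat"
  proof -
    obtain s where s: "s \<in> {a<..b}" "g t = f s"
      using img less.prems by (metis imageE imageI)
    have "\<not> s < t"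
      using IH s strict_mono_onD[OF g s(1) less.prems] by auto
    then show ?thesis
      using strict_mono_onD[OF f less.prems s(1)] s(2) by (cases "s = t") auto
  qed
  then have "u t \<le> v t" "v t \<le> u t"
    using assms less.IH by metis+
  then show ?case by simp
qed

text \<open>Bead \<open>t\<close> starts at position \<open>t\<close> and has to make one step for
  each cell in row \<open>t\<close> of the shape. The same number is the value of the Grassmannian
  permutation at \<open>t\<close>.\<close>

definition bead_target :: "nat list \<Rightarrow> nat \<Rightarrow> nat \<Rightarrow> nat" where
  "bead_target l d t = part l (d - t + 1) + t"

lemma part_antimono:
  assumes "is_partition l" "1 \<le> i" "i \<le> j"
  shows "part l j \<le> part l i"
proof (cases "j \<le> length l \<and> i < j")
  case True
  then show ?thesis
    using assms by (auto simp: part_def is_partition_def sorted_wrt_iff_nth_less)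
next
  case False
  then show ?thesis
    using assms by (auto simp: part_def)
qed

lemma strict_mono_bead_target:
  assumes "is_partition l"
  shows "strict_mono_on {0<..d} (bead_target l d)"
proof (rule strict_mono_onI)
  fix r s assume "r \<in> {0<..d}" "s \<in> {0<..d}" "r < s"
  then have "part l (d - r + 1) \<le> part l (d - s + 1)"
    by (intro part_antimono[OF assms]) auto
  then show "bead_target l d r < bead_target l d s"
    using \<open>r < s\<close> by (simp add: bead_target_def)
qed

lemma bead_target_bounds:
  assumes "is_partition l" "d + part l 1 \<le> n" "t \<in> {0<..d}"
  shows "bead_target l d t \<in> {1..n}"
  using part_antimono[OF assms(1), of 1 "d - t + 1"] assms(2,3) by (auto simp: bead_target_def)

lemma grassmannian_exists:
  fixes y :: "nat \<Rightarrow> nat"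
  assumes mono: "strict_mono_on {0<..d} y" and y: "\<And>t. t \<in> {0<..d} \<Longrightarrow> y t \<in> {1..n}" and d: "d \<le> n"
  obtains u where "u permutes {1..n}" "\<And>t. t \<in> {0<..d} \<Longrightarrow> u t = y t" "strict_mono_on {d<..n} u"
proof -
  define C where "C = {1..n} - y ` {0<..d}"
  \<comment> \<open>After position \<open>d\<close>, list the values missed by \<open>y\<close> in
    increasing order.\<close>
  define u where "u t = (if t \<in> {0<..d} then y t else
      if t \<in> {d<..n} then sorted_list_of_set C ! (t - d - 1) else t)" for t
  have inj: "inj_on y {0<..d}"
    using mono by (rule strict_mono_on_imp_inj_on)
  have "card C = card {1..n} - card (y ` {0<..d})"
    unfolding C_def using y by (intro card_Diff_subset) auto
  then have "card C = n - d"
    using inj by (simp add: card_image)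
  then have len: "length (sorted_list_of_set C) = n - d" by simp
  have set: "set (sorted_list_of_set C) = C"
    by (simp add: C_def)
  have sorted: "sorted_wrt (<) (sorted_list_of_set C)"
    by simp
  have smono: "strict_mono_on {d<..n} u"
  proof (rule strict_mono_onI)
    fix r s assume "r \<in> {d<..n}" "s \<in> {d<..n}" "r < s"
    then show "u r < u s"
      using sorted len unfolding u_def sorted_wrt_iff_nth_less by auto
  qed
  have uC: "u t \<in> C" if "t \<in> {d<..n}" for t
  proof -
    have "u t = sorted_list_of_set C ! (t - d - 1)"
      using that by (simp add: u_def)
    moreover have "t - d - 1 < n - d"
      using that by auto
    ultimately show ?thesis
      using len set by (metis nth_mem)
  qed
  have uy: "u t = y t" if "t \<in> {0<..d}" for t
    using that by (simp add: u_def)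
  have split: "{1..n} = {0<..d} \<union> {d<..n}"
    using d by auto
  have "inj_on u {0<..d}"
    using inj uy by (metis inj_on_cong)
  moreover have "inj_on u {d<..n}"
    using smono by (rule strict_mono_on_imp_inj_on)
  moreover have "u ` {0<..d} \<inter> u ` {d<..n} = {}"
  proof -
    have "u ` {d<..n} \<subseteq> C" "u ` {0<..d} = y ` {0<..d}"
      using uC uy by auto
    then show ?thesis
      by (auto simp: C_def)
  qed
  ultimately have "inj_on u {1..n}"
    unfolding split by (subst inj_on_Un) auto
  moreover have "u ` {1..n} \<subseteq> {1..n}"
  proof
    fix x assume "x \<in> u ` {1..n}"
    then obtain t where "t \<in> {0<..d} \<union> {d<..n}" "x = u t"
      unfolding split by blast
    then show "x \<in> {1..n}"
      using uC[of t] uy[of t] y[of t] unfolding C_def by auto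
  qed
  ultimately have "bij_betw u {1..n} {1..n}"
    by (simp add: bij_betw_def endo_inj_surj)
  moreover have "u t = t" if "t \<notin> {1..n}" for t
    using that d by (auto simp: u_def)
  ultimately have "u permutes {1..n}"
    by (rule bij_imp_permutes)
  then show ?thesis
    using that uy smono by blast
qed

lemma grassmannian_spec:
  assumes l: "is_partition l" and n: "d + part l 1 \<le> n"
  shows "grassmannian n l d permutes {1..n} \<and>
    (\<forall>t\<in>{0<..d}. grassmannian n l d t = bead_target l d t) \<and>
    strict_mono_on {d<..n} (grassmannian n l d)"
proof -
  let ?P = "\<lambda>u. u permutes {1..n} \<and> (\<forall>t\<in>{1..d}. u t = part l (d - t + 1) + t) \<and>
     strict_mono_on {d + 1..n} u"
  have intervals: "{1..d} = {0<..d}" "{d + 1..n} = {d<..n}"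
    by auto
  obtain u where u: "u permutes {1..n}" "\<And>t. t \<in> {0<..d} \<Longrightarrow> u t = bead_target l d t"
    "strict_mono_on {d<..n} u"
    using grassmannian_exists[OF strict_mono_bead_target[OF l] bead_target_bounds[OF l n]] n by auto
  have unique: "v = u" if "?P v" for v
  proof -
    have v: "v permutes {1..n}" "\<And>t. t \<in> {0<..d} \<Longrightarrow> v t = bead_target l d t"
      "strict_mono_on {d<..n} v"
      using that unfolding intervals by (auto simp: bead_target_def)
    \<comment> \<open>The values after position \<open>d\<close> are the complement of the first
      \<open>d\<close> values, so monotonicity leaves no choice for them.\<close>
    have img: "w ` {d<..n} = {1..n} - bead_target l d ` {0<..d}"
      if "w permutes {1..n}" "\<And>t. t \<in> {0<..d} \<Longrightarrow> w t = bead_target l d t" for w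
    proof -
      have "{d<..n} = {1..n} - {0<..d}"
        by auto
      then have "w ` {d<..n} = w ` {1..n} - w ` {0<..d}"
        using image_set_diff[OF permutes_inj[OF that(1)]] by simp
      moreover have "w ` {0<..d} = bead_target l d ` {0<..d}"
        using that(2) by simp
      ultimately show ?thesis
        using permutes_image[OF that(1)] by simp
    qed
    show ?thesis
    proof
      fix t
      consider "t \<in> {0<..d}" | "t \<in> {d<..n}" | "t \<notin> {1..n}"
        by (cases "t \<in> {1..n}"; cases "t \<le> d") auto
      then show "v t = u t"
      proof cases
        case 2
        then show ?thesis
          using strict_mono_on_eqI[OF v(3) u(3)] img[OF v(1,2)] img[OF u(1,2)] by simp
      next
        case 3
        then show ?thesis
          using u(1) v(1) by (simp add: permutes_not_in)
      qed (simp add: u v)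
    qed
  qed
  have "?P u"
    unfolding intervals using u by (auto simp: bead_target_def)
  then have "grassmannian n l d = u"
    unfolding grassmannian_def using unique by (rule the_equality)
  then show ?thesis
    using u by blast
qed

lemma grassmannian_permutes:
  "is_partition l \<Longrightarrow> d + part l 1 \<le> n \<Longrightarrow> grassmannian n l d permutes {1..n}"
  using grassmannian_spec by blast

lemma card_initial_split:
  fixes d i :: nat
  assumes "d \<le> i"
  shows "card {t\<in>{0<..i}. P t} = card {t\<in>{0<..d}. P t} + card {t\<in>{d<..i}. P t}"
proof -
  have "{t\<in>{0<..i}. P t} = {t\<in>{0<..d}. P t} \<union> {t\<in>{d<..i}. P t}"
    using assms by auto
  then show ?thesis
    by (simp add: card_Un_disjoint disjoint_iff)
qed

text \<open>A permutation with a single descent at \<open>d\<close> has its essential set in row \<open>d\<close>.\<close>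

lemma bruhat_ge_grassmannian_iff:
  fixes u w :: "nat \<Rightarrow> nat"
  assumes u: "u permutes {1..n}" "strict_mono_on {0<..d} u" "strict_mono_on {d<..n} u" and d: "d \<le> n"
    and w: "w permutes {1..m}" "n \<le> m"
  shows "(\<forall>i\<in>{1..n}. \<forall>j\<in>{1..n}. card {t\<in>{1..i}. w t \<le> j} \<le> card {t\<in>{1..i}. u t \<le> j}) \<longleftrightarrow>
    (\<forall>j\<in>{1..n}. card {t\<in>{0<..d}. w t \<le> j} \<le> card {t\<in>{0<..d}. u t \<le> j})"
    (is "?L \<longleftrightarrow> ?R")
proof
  have interval: "{1..i} = {0<..i}" for i :: nat
    by auto
  {
    assume L: ?L
    then show ?R
    proof (cases "d = 0")
      case False
      then have "d \<in> {1..n}"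
        using d by simp
      then show ?thesis
        using L unfolding interval by blast
    qed simp
  }
  assume R: ?R
  show ?L
  proof (intro ballI)
    fix i j assume i: "i \<in> {1..n}" and j: "j \<in> {1..n}"
    have le: "card {t\<in>{a<..b}. w t \<le> j} \<le> b - a" for a b
    proof -
      have "card {t\<in>{a<..b}. w t \<le> j} \<le> card {a<..b}"
        by (intro card_mono) auto
      then show ?thesis by simp
    qed
    have Rj: "card {t\<in>{0<..d}. w t \<le> j} \<le> card {t\<in>{0<..d}. u t \<le> j}"
      using R j by simp
    \<comment> \<open>Let \<open>r\<close> be the count for \<open>u\<close> in row
      \<open>d\<close>. In row \<open>i\<close> the count for \<open>u\<close> is
      \<open>min i r\<close> if \<open>i \<le> d\<close>, and the minimum of \<open>j\<close> and
      \<open>r + (i - d)\<close> otherwise. The corresponding expressions for \<open>w\<close> are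
      upper bounds for its count.\<close>
    show "card {t\<in>{1..i}. w t \<le> j} \<le> card {t\<in>{1..i}. u t \<le> j}"
    proof (cases "i \<le> d")
      case True
      then have "card {t\<in>{0<..i}. w t \<le> j} \<le> card {t\<in>{0<..d}. w t \<le> j}"
        by (intro card_mono) auto
      then show ?thesis
        using card_initial_mono[OF u(2), of i j] True Rj le[of 0 i] unfolding interval by simp
    next
      case False
      then have "d \<le> i" "i \<le> n"
        using i by auto
      have "card {t\<in>{0<..n}. u t \<le> j} = j"
        using card_permutes_le[OF u(1)] j unfolding interval by simp
      then have "card {t\<in>{d<..n}. u t \<le> j} = j - card {t\<in>{0<..d}. u t \<le> j}"
        using card_initial_split[OF d, of "\<lambda>t. u t \<le> j"] by simp
      then have "card {t\<in>{0<..i}. u t \<le> j} =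
          card {t\<in>{0<..d}. u t \<le> j} + min (i - d) (j - card {t\<in>{0<..d}. u t \<le> j})"
        using card_initial_split[OF \<open>d \<le> i\<close>, of "\<lambda>t. u t \<le> j"]
          card_initial_mono[OF u(3) \<open>d \<le> i\<close> \<open>i \<le> n\<close>, of j] by simp
      moreover have "card {t\<in>{0<..i}. w t \<le> j} \<le> j"
        using card_le_min_permutes[OF w(1), of i j] i j w(2) unfolding interval by simp
      moreover have "card {t\<in>{0<..i}. w t \<le> j} \<le> card {t\<in>{0<..d}. w t \<le> j} + (i - d)"
        using card_initial_split[OF \<open>d \<le> i\<close>, of "\<lambda>t. w t \<le> j"] le[of d i] by simp
      ultimately show ?thesis
        using Rj unfolding interval by linarith
    qed
  qed
qed

lemma dominates_iff_card_le:
  fixes x y :: "nat \<Rightarrow> nat"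
  assumes x: "strict_mono_on {0<..d} x" and y: "strict_mono_on {0<..d} y"
    and pos: "\<And>a. a \<in> {0<..d} \<Longrightarrow> 1 \<le> x a" and n: "\<And>a. a \<in> {0<..d} \<Longrightarrow> y a \<in> {1..n}"
  shows "(\<forall>j\<in>{1..n}. card {a\<in>{0<..d}. x a \<le> j} \<le> card {a\<in>{0<..d}. y a \<le> j}) \<longleftrightarrow>
    (\<forall>a\<in>{0<..d}. y a \<le> x a)" (is "?L \<longleftrightarrow> ?R")
proof
  assume ?R
  then show ?L
    by (auto intro!: card_mono intro: order_trans)
next
  assume L: ?L
  show ?R
  proof (rule ccontr)
    assume "\<not> ?R"
    then obtain a where a: "a \<in> {0<..d}" "x a < y a"
      by auto
    \<comment> \<open>This threshold admits at least \<open>a\<close> values of \<open>x\<close>,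
      but fewer than \<open>a\<close> values of \<open>y\<close>.\<close>
    define j where "j = y a - 1"
    have j: "j \<in> {1..n}" "x a \<le> j" "j < y a"
      using n[OF a(1)] pos[OF a(1)] a by (auto simp: j_def)
    have "min a (card {t\<in>{0<..d}. x t \<le> j}) = card {t\<in>{0<..a}. x t \<le> j}"
      using card_initial_mono[OF x, of a j] a by simp
    also have "{t\<in>{0<..a}. x t \<le> j} = {0<..a}"
    proof -
      have "x t \<le> x a" if "t \<in> {0<..a}" for t
        using strict_mono_onD[OF x, of t a] that a(1) by (cases "t = a") auto
      then show ?thesis
        using j(2) by (auto intro: order_trans[of "x _" "x a"])
    qed
    finally have "a \<le> card {t\<in>{0<..d}. x t \<le> j}" by simp
    moreover have "{t\<in>{0<..d}. y t \<le> j} \<subseteq> {0<..<a}"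
    proof
      fix t assume t: "t \<in> {t\<in>{0<..d}. y t \<le> j}"
      then show "t \<in> {0<..<a}"
        using strict_mono_onD[OF y, of a t] a(1) j(3) by (cases t a rule: linorder_cases) auto
    qed
    then have "card {t\<in>{0<..d}. y t \<le> j} \<le> a - 1"
      using card_mono[of "{0<..<a}" "{t\<in>{0<..d}. y t \<le> j}"] by simp
    moreover have "card {t\<in>{0<..d}. x t \<le> j} \<le> card {t\<in>{0<..d}. y t \<le> j}"
      using L j(1) by blast
    ultimately show False
      using a(1) by auto
  qed
qed

section \<open>The Demazure product and beads\<close>

lemma simple_transp_left [simp]: "simple_transp k k = Suc k"
  by (simp add: simple_transp_def)

lemma simple_transp_right [simp]: "simple_transp k (Suc k) = k"
  by (simp add: simple_transp_def)

lemma simple_transp_other [simp]: "a \<noteq> k \<Longrightarrow> a \<noteq> Suc k \<Longrightarrow> simple_transp k a = a"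
  by (simp add: simple_transp_def)

lemma simple_transp_involutory [simp]: "simple_transp k (simple_transp k a) = a"
  by (simp add: simple_transp_def)

lemma simple_transp_comp_self [simp]: "simple_transp k \<circ> simple_transp k = id"
  by auto

lemma simple_transp_permutes:
  assumes "k \<in> {1..<N}"
  shows "simple_transp k permutes {1..N}"
  unfolding simple_transp_def using assms by (intro permutes_swap_id) auto

lemma simple_transp_less:
  assumes "a < b" "\<not> (a = k \<and> b = Suc k)"
  shows "simple_transp k a < simple_transp k b"
  using assms by (cases "a = k"; cases "a = Suc k"; cases "b = k"; cases "b = Suc k") auto

lemma simple_transp_less_iff:
  assumes "\<not> (a = k \<and> b = Suc k)" "\<not> (a = Suc k \<and> b = k)"
  shows "simple_transp k a < simple_transp k b \<longleftrightarrow> a < b"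
  using simple_transp_less[of a b k] simple_transp_less[of b a k] assms
  by (metis less_asym linorder_neqE_nat)

section \<open>Inversions and the length test in the Demazure product\<close>

definition inversions :: "(nat \<Rightarrow> nat) \<Rightarrow> (nat \<times> nat) set" where
  "inversions w = {(i, j). i < j \<and> w j < w i}"

text \<open>Without finiteness \<open>coxeter_length\<close> would carry no information, since
  \<open>card\<close> is 0 on infinite sets.\<close>

lemma finite_inversions:
  assumes w: "w permutes {1..N}"
  shows "finite (inversions w)"
proof (rule finite_subset)
  show "inversions w \<subseteq> {..N} \<times> {..N}"
  proof (clarsimp simp: inversions_def)
    fix i j assume ij: "i < j" "w j < w i"
    have "w t \<le> N \<longleftrightarrow> t \<le> N" for t
      using permutes_in_image[OF w, of t] permutes_not_in[OF w, of t] by (cases "t \<in> {1..N}") auto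
    moreover have "w t = t" if "N < t" for t
      using permutes_not_in[OF w, of t] that by simp
    ultimately show "i \<le> N \<and> j \<le> N"
      using ij by (metis less_trans linorder_not_le order_less_imp_le)
  qed
qed simp

text \<open>Applying the transposition to both coordinates carries the old inversions injectively to
  new ones, because the swapped pair is not among them; that pair is the only additional
  inversion.\<close>

lemma card_inversions_transp:
  assumes less: "w k < w (Suc k)" and fin: "finite (inversions w)"
  shows "card (inversions (w \<circ> simple_transp k)) = Suc (card (inversions w))"
proof -
  let ?s = "simple_transp k"
  have "inversions (w \<circ> ?s) = insert (k, Suc k) (map_prod ?s ?s ` inversions w)"
  proof (intro set_eqI iffI)
    fix p assume p: "p \<in> inversions (w \<circ> ?s)"
    obtain i j where [simp]: "p = (i, j)" by (cases p)
    show "p \<in> insert (k, Suc k) (map_prod ?s ?s ` inversions w)"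
    proof (cases "p = (k, Suc k)")
      case False
      then have "(?s i, ?s j) \<in> inversions w"
        using p simple_transp_less[of i j k] by (auto simp: inversions_def)
      then show ?thesis
        by (intro insertI2 image_eqI[of _ _ "(?s i, ?s j)"]) simp_all
    qed simp
  next
    fix p assume "p \<in> insert (k, Suc k) (map_prod ?s ?s ` inversions w)"
    then consider "p = (k, Suc k)" | i j where "(i, j) \<in> inversions w" "p = (?s i, ?s j)"
      by auto
    then show "p \<in> inversions (w \<circ> ?s)"
    proof cases
      case 1
      then show ?thesis using less by (simp add: inversions_def)
    next
      case 2
      then have "i < j" "w j < w i"
        by (auto simp: inversions_def)
      moreover from this have "\<not> (i = k \<and> j = Suc k)"
        using less by auto
      ultimately show ?thesis
        using simple_transp_less[of i j k] 2(2) by (simp add: inversions_def)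
    qed
  qed
  moreover have "(k, Suc k) \<notin> map_prod ?s ?s ` inversions w"
  proof
    assume "(k, Suc k) \<in> map_prod ?s ?s ` inversions w"
    then obtain i j where "(i, j) \<in> inversions w" "k = ?s i" "Suc k = ?s j"
      by auto
    then have "(?s k, ?s (Suc k)) \<in> inversions w"
      by (metis simple_transp_involutory)
    then show False
      by (simp add: inversions_def)
  qed
  moreover have "inj (map_prod ?s ?s)"
    by (metis injI prod.inj_map simple_transp_involutory)
  ultimately show ?thesis
    using fin by (simp add: card_image inj_on_subset[of _ UNIV])
qed

lemma demazure_mult_simple_transp:
  assumes w: "w permutes {1..N}" and k: "k \<in> {1..<N}"
  shows "demazure_mult w (simple_transp k) =
    (if w k < w (Suc k) then w \<circ> simple_transp k else w)"
proof -
  let ?s = "simple_transp k"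
  have len: "coxeter_length v = card (inversions v)" for v
    by (simp add: coxeter_length_def inversions_def)
  have ws: "w \<circ> ?s permutes {1..N}"
    using permutes_compose[OF simple_transp_permutes[OF k] w] .
  show ?thesis
  proof (cases "w k < w (Suc k)")
    case True
    then show ?thesis
      using card_inversions_transp[OF True finite_inversions[OF w]]
      by (simp add: demazure_mult_def len)
  next
    case False
    have "w k \<noteq> w (Suc k)"
      using permutes_inj[OF w] by (metis injD n_not_Suc_n)
    \<comment> \<open>Now \<open>w \<circ> ?s\<close> ascends at \<open>k\<close>, so the count of
      inversions applied to it shows that \<open>w\<close> is the longer of the two.\<close>
    then have "(w \<circ> ?s) k < (w \<circ> ?s) (Suc k)"
      using False by simp
    then have "card (inversions (w \<circ> ?s \<circ> ?s)) = Suc (card (inversions (w \<circ> ?s)))"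
      using finite_inversions[OF ws] by (rule card_inversions_transp)
    then have "card (inversions w) = Suc (card (inversions (w \<circ> ?s)))"
      by (simp add: comp_assoc)
    then show ?thesis
      using False by (simp add: demazure_mult_def len)
  qed
qed

section \<open>Demazure operators acting on the left\<close>

definition left_demazure :: "nat \<Rightarrow> (nat \<Rightarrow> nat) \<Rightarrow> (nat \<Rightarrow> nat)" where
  "left_demazure k w = (if inv w k < inv w (Suc k) then simple_transp k \<circ> w else w)"

lemma left_demazure_permutes:
  assumes "w permutes {1..N}" "k \<in> {1..<N}"
  shows "left_demazure k w permutes {1..N}"
  unfolding left_demazure_def
  using permutes_compose[OF assms(1) simple_transp_permutes[OF assms(2)]] assms(1) by auto

lemma demazure_mult_permutes:
  assumes "w permutes {1..N}" "k \<in> {1..<N}"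
  shows "demazure_mult w (simple_transp k) permutes {1..N}"
  unfolding demazure_mult_def
  using permutes_compose[OF simple_transp_permutes[OF assms(2)] assms(1)] assms(1) by auto

text \<open>If the values \<open>k\<close>, \<open>Suc k\<close> occupy the positions
  \<open>j\<close>, \<open>Suc j\<close> in this order, both operators perform the same swap and the
  second one to act finds a descent. In the opposite order neither acts. In all other cases neither
  operator affects the test made by the other.\<close>

lemma left_demazure_demazure_mult:
  assumes w: "w permutes {1..N}" and j: "j \<in> {1..<N}" and k: "k \<in> {1..<N}"
  shows "demazure_mult (left_demazure k w) (simple_transp j)
    = left_demazure k (demazure_mult w (simple_transp j))"
proof -
  define p q where "p = inv w k" and "q = inv w (Suc k)"
  have wi: "w x = y \<longleftrightarrow> x = inv w y" for x y
    using permutes_inverses[OF w] by metis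
  have "p \<noteq> q"
    using wi by (metis p_def q_def n_not_Suc_n)
  have wp: "w p = k" "w q = Suc k"
    unfolding p_def q_def using wi by blast+
  have inv_ws: "inv (w \<circ> simple_transp j) x = simple_transp j (inv w x)" for x
  proof -
    have "(w \<circ> simple_transp j) (simple_transp j (inv w x)) = x"
      using permutes_inverses[OF w] by simp
    moreover have "inj (w \<circ> simple_transp j)"
      using permutes_inj[OF permutes_compose[OF simple_transp_permutes[OF j] w]] .
    ultimately show ?thesis
      by (metis inv_f_f)
  qed
  note dm = demazure_mult_simple_transp[OF left_demazure_permutes[OF w k] j]
    demazure_mult_simple_transp[OF w j]
  consider "p = j \<and> q = Suc j" | "p = Suc j \<and> q = j"
    | "\<not> (p = j \<and> q = Suc j)" "\<not> (p = Suc j \<and> q = j)"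
    by blast
  then show ?thesis
  proof cases
    case 1
    then have "simple_transp k \<circ> w = w \<circ> simple_transp j"
    proof (intro ext)
      fix x
      show "(simple_transp k \<circ> w) x = (w \<circ> simple_transp j) x"
        using wp 1 wi[of x k] wi[of x "Suc k"] p_def q_def
        by (cases "x = j"; cases "x = Suc j") auto
    qed
    moreover have "left_demazure k w = simple_transp k \<circ> w"
      using 1 p_def q_def by (simp add: left_demazure_def)
    moreover have "w j = k" "w (Suc j) = Suc k"
      using 1 wp by auto
    moreover have "left_demazure k (w \<circ> simple_transp j) = w \<circ> simple_transp j"
      unfolding left_demazure_def inv_ws using 1 p_def q_def by auto
    ultimately show ?thesis
      unfolding dm by simp
  next
    case 2
    then have "left_demazure k w = w"
      using p_def q_def by (auto simp: left_demazure_def)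
    moreover have "w j = Suc k" "w (Suc j) = k"
      using 2 wp by auto
    ultimately show ?thesis
      unfolding dm by simp
  next
    case 3
    have "\<not> (w j = k \<and> w (Suc j) = Suc k)" "\<not> (w j = Suc k \<and> w (Suc j) = k)"
      using 3 wi p_def q_def by metis+
    then have 1: "simple_transp k (w j) < simple_transp k (w (Suc j)) \<longleftrightarrow> w j < w (Suc j)"
      by (rule simple_transp_less_iff)
    have 2: "simple_transp j p < simple_transp j q \<longleftrightarrow> p < q"
      using 3 by (intro simple_transp_less_iff) auto
    have "left_demazure k (w \<circ> simple_transp j) =
        (if p < q then simple_transp k \<circ> w \<circ> simple_transp j else w \<circ> simple_transp j)"
      unfolding left_demazure_def inv_ws p_def[symmetric] q_def[symmetric] 2 by (simp add: comp_assoc)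
    moreover have "left_demazure k w = (if p < q then simple_transp k \<circ> w else w)"
      by (simp add: left_demazure_def p_def q_def)
    ultimately show ?thesis
      unfolding dm using 1 by simp
  qed
qed

lemma foldl_left_demazure:
  assumes "w permutes {1..N}" "set ks \<subseteq> {1..<N}" "k \<in> {1..<N}"
  shows "foldl demazure_mult (left_demazure k w) (map simple_transp ks)
    = left_demazure k (foldl demazure_mult w (map simple_transp ks))"
  using assms
proof (induction ks arbitrary: w)
  case (Cons j ks)
  then have "j \<in> {1..<N}" by simp
  then show ?case
    using Cons demazure_mult_permutes[of w N j] by (simp add: left_demazure_demazure_mult)
qed simp

lemma demazure_product_permutes:
  assumes "set ks \<subseteq> {1..<N}"
  shows "demazure_product (map simple_transp ks) permutes {1..N}"
proof -
  have "foldl demazure_mult w (map simple_transp ks) permutes {1..N}" if "w permutes {1..N}" for w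
    using that assms
  proof (induction ks arbitrary: w)
    case (Cons k ks)
    then show ?case
      using demazure_mult_permutes[of w N k] by simp
  qed simp
  then show ?thesis
    unfolding demazure_product_def by (simp add: permutes_id)
qed

text \<open>On the identity the left and right actions agree. The left action of the first letter
  then commutes past all later right multiplications.\<close>

lemma demazure_product_Cons:
  assumes "set ks \<subseteq> {1..<N}" "k \<in> {1..<N}"
  shows "demazure_product (map simple_transp (k # ks))
    = left_demazure k (demazure_product (map simple_transp ks))"
proof -
  have "demazure_mult id (simple_transp k) = left_demazure k id"
    using demazure_mult_simple_transp[OF permutes_id assms(2)] by (simp add: left_demazure_def)
  then show ?thesis
    using foldl_left_demazure[OF permutes_id assms] by (simp add: demazure_product_def)
qed

text \<open>
  Reading a word from right to left, the Demazure product acts on the set of its first \<open>d\<close>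
  values as on beads: the letter \<open>k\<close> moves a bead from \<open>k\<close> to \<open>k + 1\<close> unless \<open>k + 1\<close> is occupied.
\<close>

definition move_bead :: "nat \<Rightarrow> nat \<Rightarrow> (nat \<Rightarrow> nat) \<Rightarrow> nat \<Rightarrow> nat" where
  "move_bead d k x a =
     (if a \<in> {0<..d} \<and> x a = k \<and> Suc k \<notin> x ` {0<..d} then Suc k else x a)"

definition beads :: "nat \<Rightarrow> nat list \<Rightarrow> nat \<Rightarrow> nat" where
  "beads d ks = foldr (move_bead d) ks id"

lemma beads_Nil [simp]: "beads d [] = id"
  by (simp add: beads_def)

lemma beads_Cons [simp]: "beads d (k # ks) = move_bead d k (beads d ks)"
  by (simp add: beads_def)

lemma move_bead_image:
  "move_bead d k x ` {0<..d} =
    (let S = x ` {0<..d} in if k \<in> S \<and> Suc k \<notin> S then simple_transp k ` S else S)"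
proof (cases "k \<in> x ` {0<..d} \<and> Suc k \<notin> x ` {0<..d}")
  case True
  then have "move_bead d k x a = simple_transp k (x a)" if "a \<in> {0<..d}" for a
  proof (cases "x a = k")
    case False
    moreover have "x a \<noteq> Suc k"
      using True that by (metis imageI)
    ultimately show ?thesis by (simp add: move_bead_def)
  qed (use True that in \<open>simp add: move_bead_def\<close>)
  then have "move_bead d k x ` {0<..d} = simple_transp k ` x ` {0<..d}"
    by (simp add: image_image)
  then show ?thesis using True by (simp add: Let_def)
next
  case False
  then have "move_bead d k x a = x a" if "a \<in> {0<..d}" for a
    using that by (auto simp: move_bead_def)
  then have "move_bead d k x ` {0<..d} = x ` {0<..d}"
    by simp
  then show ?thesis using False by (auto simp: Let_def)
qed

text \<open>The right-hand side is the one in \<open>move_bead_image\<close>, so the value set and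
  the beads evolve alike. If exactly one of \<open>k\<close>, \<open>Suc k\<close> is in the set, it
  has the smaller position, and membership decides the test; otherwise the swap preserves the set
  and the outcome of the test is irrelevant.\<close>

lemma left_demazure_image:
  assumes w: "w permutes {1..N}" and k: "k \<in> {1..<N}"
  shows "left_demazure k w ` {0<..d} =
    (let S = w ` {0<..d} in if k \<in> S \<and> Suc k \<notin> S then simple_transp k ` S else S)"
proof -
  define S where "S = w ` {0<..d}"
  have mem: "y \<in> S \<longleftrightarrow> inv w y \<le> d" if "y \<in> {1..N}" for y
  proof -
    have "inv w y \<in> {1..N}"
      using permutes_in_image[OF permutes_inv[OF w]] that by blast
    moreover have "y \<in> S \<longleftrightarrow> inv w y \<in> {0<..d}"
      unfolding S_def using permutes_inverses[OF w] by (metis image_iff)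
    ultimately show ?thesis by auto
  qed
  have mem_k: "k \<in> S \<longleftrightarrow> inv w k \<le> d" "Suc k \<in> S \<longleftrightarrow> inv w (Suc k) \<le> d"
    using mem[of k] mem[of "Suc k"] k by auto
  have swap: "simple_transp k ` S = S" if "k \<in> S \<longleftrightarrow> Suc k \<in> S"
  proof -
    have "simple_transp k ` S \<subseteq> S"
    proof
      fix y assume "y \<in> simple_transp k ` S"
      then obtain z where "z \<in> S" "y = simple_transp k z" by blast
      then show "y \<in> S"
        using that by (cases "z = k"; cases "z = Suc k") auto
    qed
    moreover from this have "S \<subseteq> simple_transp k ` S"
      by (metis image_eqI simple_transp_involutory subsetD subsetI)
    ultimately show ?thesis by simp
  qed
  have "left_demazure k w ` {0<..d} = (if inv w k < inv w (Suc k) then simple_transp k ` S else S)"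
    by (simp add: left_demazure_def S_def image_comp)
  also have "\<dots> = (if k \<in> S \<and> Suc k \<notin> S then simple_transp k ` S else S)"
    using mem_k swap by (cases "k \<in> S"; cases "Suc k \<in> S") auto
  finally show ?thesis
    unfolding Let_def S_def .
qed

lemma demazure_product_image:
  assumes "set ks \<subseteq> {1..<N}"
  shows "demazure_product (map simple_transp ks) ` {0<..d} = beads d ks ` {0<..d}"
  using assms
proof (induction ks)
  case Nil
  then show ?case by (simp add: demazure_product_def)
next
  case (Cons k ks)
  then have ks: "set ks \<subseteq> {1..<N}" and k: "k \<in> {1..<N}"
    by auto
  show ?case
    unfolding demazure_product_Cons[OF ks k] beads_Cons
      left_demazure_image[OF demazure_product_permutes[OF ks] k] move_bead_image Cons.IH[OF ks] ..
qed

lemma move_bead_ge: "x a \<le> move_bead d k x a"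
  by (simp add: move_bead_def)

lemma strict_mono_move_bead:
  assumes x: "strict_mono_on {0<..d} x"
  shows "strict_mono_on {0<..d} (move_bead d k x)"
proof (rule strict_mono_onI)
  fix r s assume rs: "r \<in> {0<..d}" "s \<in> {0<..d}" "r < s"
  then have "x r < x s"
    by (rule strict_mono_onD[OF x])
  show "move_bead d k x r < move_bead d k x s"
  proof (cases "x r = k \<and> Suc k \<notin> x ` {0<..d}")
    case True
    then have "x s \<noteq> Suc k"
      using rs(2) by (metis imageI)
    then show ?thesis
      using True \<open>x r < x s\<close> move_bead_ge[of x s d k] rs(1) by (simp add: move_bead_def)
  next
    case False
    then have "move_bead d k x r = x r"
      by (auto simp: move_bead_def)
    then show ?thesis
      using \<open>x r < x s\<close> move_bead_ge[of x s d k] by simp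
  qed
qed

lemma strict_mono_beads: "strict_mono_on {0<..d} (beads d ks)"
proof (induction ks)
  case Nil
  show ?case by (auto intro: strict_mono_onI)
next
  case (Cons k ks)
  then show ?case by (simp add: strict_mono_move_bead)
qed

lemma beads_ge: "a \<le> beads d ks a"
  by (induction ks) (auto intro: order_trans move_bead_ge)

section \<open>Comparing a Demazure product with a Grassmannian permutation\<close>

lemma card_filter_image:
  assumes "inj_on f A"
  shows "card {t\<in>A. f t \<le> j} = card {y\<in>f ` A. y \<le> j}"
proof -
  have "{y\<in>f ` A. y \<le> j} = f ` {t\<in>A. f t \<le> j}"
    by auto
  moreover have "inj_on f {t\<in>A. f t \<le> j}"
    using assms by (rule inj_on_subset) auto
  ultimately show ?thesis
    by (simp add: card_image)
qed

lemma demazure_product_ge_grassmannian_iff: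
  assumes l: "is_partition l" and n: "d + part l 1 \<le> n" and ks: "set ks \<subseteq> {1..<m}" and "n \<le> m"
  shows "(\<forall>i\<in>{1..n}. \<forall>j\<in>{1..n}. card {t\<in>{1..i}. demazure_product (map simple_transp ks) t \<le> j}
      \<le> card {t\<in>{1..i}. grassmannian n l d t \<le> j})
    \<longleftrightarrow> (\<forall>a\<in>{0<..d}. bead_target l d a \<le> beads d ks a)"
proof -
  let ?u = "grassmannian n l d" and ?w = "demazure_product (map simple_transp ks)"
  have u: "?u permutes {1..n}" "\<And>t. t \<in> {0<..d} \<Longrightarrow> ?u t = bead_target l d t"
    "strict_mono_on {d<..n} ?u"
    using grassmannian_spec[OF l n] by blast+
  have w: "?w permutes {1..m}"
    by (rule demazure_product_permutes[OF ks])
  have "strict_mono_on {0<..d} ?u"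
    using strict_mono_bead_target[OF l, of d] u(2) by (simp add: strict_mono_on_def)
  then have "(\<forall>i\<in>{1..n}. \<forall>j\<in>{1..n}. card {t\<in>{1..i}. ?w t \<le> j} \<le> card {t\<in>{1..i}. ?u t \<le> j})
    \<longleftrightarrow> (\<forall>j\<in>{1..n}. card {t\<in>{0<..d}. ?w t \<le> j} \<le> card {t\<in>{0<..d}. ?u t \<le> j})"
    using u n w \<open>n \<le> m\<close> by (intro bruhat_ge_grassmannian_iff) auto
  \<comment> \<open>These counts see only the set of the first \<open>d\<close> values, so the
    values may be replaced by the bead positions, which list the same set in increasing
    order.\<close>
  also have "\<dots> \<longleftrightarrow> (\<forall>j\<in>{1..n}. card {t\<in>{0<..d}. beads d ks t \<le> j}
      \<le> card {t\<in>{0<..d}. bead_target l d t \<le> j})"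
  proof -
    have "card {t\<in>{0<..d}. ?w t \<le> j} = card {t\<in>{0<..d}. beads d ks t \<le> j}" for j
      using card_filter_image[of ?w "{0<..d}" j] card_filter_image[of "beads d ks" "{0<..d}" j]
        demazure_product_image[OF ks, of d] inj_on_subset[OF permutes_inj[OF w]]
        strict_mono_on_imp_inj_on[OF strict_mono_beads] by simp
    moreover have "{t\<in>{0<..d}. ?u t \<le> j} = {t\<in>{0<..d}. bead_target l d t \<le> j}" for j
      using u(2) by auto
    ultimately show ?thesis by simp
  qed
  also have "\<dots> \<longleftrightarrow> (\<forall>a\<in>{0<..d}. bead_target l d a \<le> beads d ks a)"
  proof (rule dominates_iff_card_le[OF strict_mono_beads strict_mono_bead_target[OF l]])
    show "1 \<le> beads d ks a" if "a \<in> {0<..d}" for a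
      using beads_ge[of a d ks] that by auto
  qed (rule bead_target_bounds[OF l n])
  finally show ?thesis .
qed

section \<open>Tableaux and beads\<close>

lemma shape_row:
  assumes "(a, b') \<in> shape l d" "1 \<le> b" "b \<le> b'"
  shows "(a, b) \<in> shape l d"
  using assms by (auto simp: shape_def)

lemma shape_column:
  assumes "is_partition l" "(a, b) \<in> shape l d" "a \<le> a'" "a' \<le> d"
  shows "(a', b) \<in> shape l d"
proof -
  have "part l (d - a + 1) \<le> part l (d - a' + 1)"
    using assms by (intro part_antimono) auto
  then show ?thesis
    using assms by (auto simp: shape_def)
qed

text \<open>Neighbouring cells suffice because rows of a shape are left-justified and its columns
  extend down to row \<open>d\<close>, so nothing is missing between two cells of a row or
  column.\<close>

lemma is_tableauI:
  assumes l: "is_partition l"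
    and range: "\<And>p. p \<in> shape l d \<Longrightarrow> X p \<in> {1..d}"
    and zero: "\<And>p. p \<notin> shape l d \<Longrightarrow> X p = 0"
    and row: "\<And>a b. (a, Suc b) \<in> shape l d \<Longrightarrow> 1 \<le> b \<Longrightarrow> X (a, Suc b) \<le> X (a, b)"
    and col: "\<And>a b. (a, b) \<in> shape l d \<Longrightarrow> a < d \<Longrightarrow> X (a, b) < X (Suc a, b)"
  shows "is_tableau l d X"
  unfolding is_tableau_def
proof (intro conjI ballI allI impI)
  fix a b b' assume "(a, b) \<in> shape l d \<and> (a, b') \<in> shape l d \<and> b < b'"
  then have "b \<le> b'" "(a, b') \<in> shape l d" "1 \<le> b"
    by (auto simp: shape_def)
  then show "X (a, b') \<le> X (a, b)"
  proof (induction b' rule: dec_induct)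
    case (step m)
    then have "(a, m) \<in> shape l d"
      using shape_row[of a "Suc m" l d m] by simp
    then show ?case
      using row[of a m] step by simp
  qed simp
next
  fix a a' b assume "(a, b) \<in> shape l d \<and> (a', b) \<in> shape l d \<and> a < a'"
  then have "Suc a \<le> a'" "(a, b) \<in> shape l d" "a' \<le> d"
    by (auto simp: shape_def)
  then show "X (a, b) < X (a', b)"
  proof (induction a' rule: dec_induct)
    case base
    then show ?case using col by simp
  next
    case (step m)
    then have "(m, b) \<in> shape l d"
      using shape_column[OF l, of a b d m] by simp
    then show ?case
      using col[of m b] step by simp
  qed
qed (use range zero in auto)

lemma is_tableau_range: "is_tableau l d X \<Longrightarrow> p \<in> shape l d \<Longrightarrow> X p \<in> {1..d}"
  unfolding is_tableau_def by blast

lemma is_tableau_zero: "is_tableau l d X \<Longrightarrow> p \<notin> shape l d \<Longrightarrow> X p = 0"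
  unfolding is_tableau_def by blast

lemma is_tableau_row:
  assumes "is_tableau l d X" "(a, b) \<in> shape l d" "(a, b') \<in> shape l d" "b \<le> b'"
  shows "X (a, b') \<le> X (a, b)"
  using assms by (cases "b = b'") (simp_all add: is_tableau_def)

lemma is_tableau_column:
  assumes "is_tableau l d X" "(a, b) \<in> shape l d" "(a', b) \<in> shape l d" "a < a'"
  shows "X (a, b) < X (a', b)"
  using assms unfolding is_tableau_def by blast

text \<open>Entries in row \<open>d\<close> are at most \<open>d\<close>, every column reaches that
  row, and each step upwards lowers the entry by at least 1.\<close>

lemma tableau_entry_le_row:
  assumes l: "is_partition l" and X: "is_tableau l d X" and p: "(a, b) \<in> shape l d"
  shows "X (a, b) \<le> a"
proof -
  have "a \<le> d"
    using p by (simp add: shape_def)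
  then show ?thesis
    using p
  proof (induction a rule: inc_induct)
    case base
    then show ?case using is_tableau_range[OF X, of "(d, b)"] by simp
  next
    case (step m)
    then have "(Suc m, b) \<in> shape l d"
      using shape_column[OF l, of m b d "Suc m"] by simp
    then show ?case
      using step is_tableau_column[OF X, of m b "Suc m"] by simp
  qed
qed

text \<open>The contribution of one colour to \<open>tableau_cells\<close>: an entry slides along
  its antidiagonal to the row that it names.\<close>

definition filling_cells :: "nat list \<Rightarrow> nat \<Rightarrow> (cell \<Rightarrow> nat) \<Rightarrow> cell set" where
  "filling_cells l d X = (\<lambda>(a, b). (X (a, b), a + b - X (a, b))) ` shape l d"

lemma filling_cellsI:
  "(a, b) \<in> shape l d \<Longrightarrow> (X (a, b), a + b - X (a, b)) \<in> filling_cells l d X"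
  by (force simp: filling_cells_def)

definition read_before :: "cell \<Rightarrow> cell \<Rightarrow> bool" where
  "read_before p q \<longleftrightarrow> fst p < fst q \<or> fst p = fst q \<and> snd q < snd p"

lemma read_before_asym: "read_before p q \<Longrightarrow> \<not> read_before q p"
  by (auto simp: read_before_def)

definition cell_index :: "cell \<Rightarrow> nat" where
  "cell_index q = fst q + snd q - 1"

abbreviation cell_beads :: "nat \<Rightarrow> cell list \<Rightarrow> nat \<Rightarrow> nat" where
  "cell_beads d W \<equiv> beads d (map cell_index W)"

text \<open>Bead \<open>a\<close> makes its step from \<open>a + b - 1\<close> to \<open>a + b\<close> at the latest in row \<open>X (a, b)\<close>.\<close>

lemma beads_ge_tableau:
  assumes l: "is_partition l" and X: "is_tableau l d X"
    and sub: "filling_cells l d X \<subseteq> set W" and sorted: "sorted_wrt read_before W"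
    and ab: "(a, b) \<in> shape l d"
  shows "a + b \<le> cell_beads d W a"
proof -
  define cell where "cell a b = (X (a, b), a + b - X (a, b))" for a b
  \<comment> \<open>The letters act from the end, hence the induction over suffixes. The prefix is
    kept in order to locate cells: whatever is read after the head of the suffix lies in its
    tail.\<close>
  have "a + b \<le> cell_beads d suf a"
    if "W = pre @ suf" "(a, b) \<in> shape l d" "cell a b \<in> set suf" for pre suf a b
    using that
  proof (induction suf arbitrary: pre a b)
    case (Cons q ss)
    let ?x = "cell_beads d ss"
    have IH: "a + b \<le> ?x a" if "(a, b) \<in> shape l d" "cell a b \<in> set ss" for a b
      using Cons.IH[of "pre @ [q]"] Cons.prems(1) that by simp
    have later: "cell a' b' \<in> set ss" if "(a', b') \<in> shape l d" "read_before q (cell a' b')" for a' b'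
    proof -
      have "cell a' b' \<in> set pre \<union> {q} \<union> set ss"
        using sub that(1) Cons.prems(1) filling_cellsI[of a' b' l d X] by (auto simp: cell_def)
      moreover have "\<not> read_before (cell a' b') q"
        using that(2) by (rule read_before_asym)
      moreover from this have "cell a' b' \<noteq> q"
        using that(2) by metis
      moreover have "read_before p q" if "p \<in> set pre" for p
        using sorted Cons.prems(1) that by (simp add: sorted_wrt_append)
      ultimately show ?thesis by blast
    qed
    show ?case
    proof (cases "cell a b \<in> set ss")
      case True
      then show ?thesis
        using IH[OF Cons.prems(2)] move_bead_ge[of ?x a d "cell_index q"] by simp
    next
      case False
      then have q: "q = cell a b"
        using Cons.prems(3) by simp
      have Xa: "X (a, b) \<le> a" and b: "1 \<le> b" and a: "1 \<le> a" "a \<le> d"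
        using tableau_entry_le_row[OF l X] Cons.prems(2) by (auto simp: shape_def)
      then have k: "cell_index q = a + b - 1"
        by (simp add: q cell_def cell_index_def)
      \<comment> \<open>The preceding step of bead \<open>a\<close> has its cell in a lower row, or
        in the same row further left, and so later in the word.\<close>
      have "a + b - 1 \<le> ?x a"
      proof (cases "b = 1")
        case True
        then show ?thesis using beads_ge[of a d] by simp
      next
        case False
        then have ab': "(a, b - 1) \<in> shape l d"
          using shape_row[OF Cons.prems(2), of "b - 1"] b by simp
        then have "X (a, b) \<le> X (a, b - 1)"
          using is_tableau_row[OF X _ Cons.prems(2)] by simp
        moreover have "X (a, b - 1) \<le> a"
          using tableau_entry_le_row[OF l X ab'] .
        ultimately have "read_before q (cell a (b - 1))"
          using False b by (auto simp: q cell_def read_before_def)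
        then have "a + (b - 1) \<le> ?x a"
          using IH[OF ab'] later[OF ab'] by blast
        then show ?thesis using b by simp
      qed
      \<comment> \<open>A blocking bead \<open>a'\<close> would lie beyond bead \<open>a\<close>.
        But bead \<open>a + 1\<close> has already made its \<open>b\<close>-th step, whose cell is
        in a strictly lower row, so it and all beads after it stand beyond
        \<open>a + b\<close>.\<close>
      moreover have "a + b \<notin> ?x ` {0<..d}" if xa: "?x a = a + b - 1"
      proof
        assume "a + b \<in> ?x ` {0<..d}"
        then obtain a' where a': "a' \<in> {0<..d}" "?x a' = a + b"
          by auto
        have "a < a'"
          using a' xa a b strict_mono_onD[OF strict_mono_beads, of a' d a "map cell_index ss"]
          by (cases a a' rule: linorder_cases) simp_all
        then have ab': "(Suc a, b) \<in> shape l d"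
          using shape_column[OF l Cons.prems(2), of "Suc a"] a' by simp
        have "X (a, b) < X (Suc a, b)"
          using is_tableau_column[OF X Cons.prems(2) ab'] by simp
        then have "read_before q (cell (Suc a) b)"
          by (simp add: q cell_def read_before_def)
        then have "Suc a + b \<le> ?x (Suc a)"
          using IH[OF ab'] later[OF ab'] by blast
        also have "?x (Suc a) \<le> ?x a'"
          using strict_mono_onD[OF strict_mono_beads, of "Suc a" d a' "map cell_index ss"] \<open>a < a'\<close> a'
          by (cases "Suc a = a'") simp_all
        finally show False
          using a'(2) by simp
      qed
      ultimately have "a + b \<le> move_bead d (a + b - 1) ?x a"
        using a b by (auto simp: move_bead_def)
      then show ?thesis
        by (simp add: k)
    qed
  qed simp
  moreover have "cell a b \<in> set W"
    using sub filling_cellsI[OF ab] unfolding cell_def by blast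
  ultimately show ?thesis
    using ab by simp
qed

text \<open>\<open>G (a, b)\<close> records the row in which bead \<open>a\<close> makes its \<open>b\<close>-th step.\<close>

definition step_record :: "nat \<Rightarrow> cell list \<Rightarrow> (cell \<Rightarrow> nat) \<Rightarrow> bool" where
  "step_record d W G \<longleftrightarrow> (\<forall>a\<in>{0<..d}. \<forall>b\<ge>1. a + b \<le> cell_beads d W a \<longrightarrow>
     G (a, b) \<in> {1..d} \<and> (G (a, b), a + b - G (a, b)) \<in> set W \<and>
     (1 < b \<longrightarrow> G (a, b) \<le> G (a, b - 1)) \<and> (a < d \<longrightarrow> G (a, b) < G (Suc a, b)))"

text \<open>Induction from the end of the word. A letter moves at most one bead, and a move adds the
  single entry \<open>i\<close>, the row of the letter. The inequalities for it hold because all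
  cells recorded so far lie in lower rows or further left in row \<open>i\<close>.\<close>

lemma step_record_exists:
  assumes "sorted_wrt read_before W" "\<And>q. q \<in> set W \<Longrightarrow> 1 \<le> fst q \<and> 1 \<le> snd q"
  shows "\<exists>G. step_record d W G"
  using assms
proof (induction W)
  case Nil
  then show ?case by (auto simp: step_record_def)
next
  case (Cons q ss)
  define x where "x = cell_beads d ss"
  define k where "k = cell_index q"
  obtain i j where q: "q = (i, j)" by (cases q)
  have ij: "1 \<le> i" "1 \<le> j" "Suc k = i + j"
    using Cons.prems(2)[of q] by (auto simp: q k_def cell_index_def)
  have later: "i < fst p \<or> i = fst p \<and> snd p < j" if "p \<in> set ss" for p
    using Cons.prems(1) that by (auto simp: q read_before_def)
  obtain G where "step_record d ss G"
    using Cons by auto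
  then have G: "G (a, b) \<in> {1..d}" "(G (a, b), a + b - G (a, b)) \<in> set ss"
      "1 < b \<Longrightarrow> G (a, b) \<le> G (a, b - 1)" "a < d \<Longrightarrow> G (a, b) < G (Suc a, b)"
    if "a \<in> {0<..d}" "1 \<le> b" "a + b \<le> x a" for a b
    using that unfolding step_record_def x_def by blast+
  have mono: "x a < x a'" if "a \<in> {0<..d}" "a' \<in> {0<..d}" "a < a'" for a a'
    using strict_mono_onD[OF strict_mono_beads that] by (simp add: x_def)
  have x': "cell_beads d (q # ss) = move_bead d k x"
    by (simp add: x_def k_def)
  show ?case
  proof (cases "\<exists>a\<in>{0<..d}. x a = k \<and> Suc k \<notin> x ` {0<..d}")
    case False
    then have "move_bead d k x = x"
      by (intro ext) (auto simp: move_bead_def)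
    then have "step_record d (q # ss) G"
      unfolding step_record_def x' using G by simp
    then show ?thesis by blast
  next
    case True
    then obtain a0 where a0: "a0 \<in> {0<..d}" "x a0 = k" and free: "Suc k \<notin> x ` {0<..d}"
      by blast
    have "a0 \<le> k"
      using beads_ge[of a0 d "map cell_index ss"] a0(2) by (simp add: x_def)
    \<comment> \<open>Bead \<open>a0\<close> started at \<open>a0\<close> and now reaches
      \<open>Suc k\<close>, so this is its step number \<open>b0\<close>.\<close>
    define b0 where "b0 = Suc k - a0"
    have b0: "1 \<le> b0" "a0 + b0 = Suc k"
      using \<open>a0 \<le> k\<close> by (auto simp: b0_def)
    have moved: "move_bead d k x a = (if a = a0 then Suc k else x a)" if "a \<in> {0<..d}" for a
      using that a0 free mono[of a a0] mono[of a0 a]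
      by (cases a a0 rule: linorder_cases) (simp_all add: move_bead_def)
    have left: "i \<le> G (a0, b0 - 1)" "G (a0, b0 - 1) \<le> d" if "1 < b0"
    proof -
      have "a0 + (b0 - 1) \<le> x a0" "1 \<le> b0 - 1"
        using that b0 a0 by auto
      then show "i \<le> G (a0, b0 - 1)" "G (a0, b0 - 1) \<le> d"
        using G(1,2)[OF a0(1), of "b0 - 1"] later by fastforce+
    qed
    \<comment> \<open>Bead \<open>a0 + 1\<close> is beyond \<open>k\<close> and not on
      \<open>Suc k\<close>, so its \<open>b0\<close>-th step is recorded. In row \<open>i\<close>
      that step would use column \<open>j + 1\<close>, which precedes the current letter in the
      word.\<close>
    have below: "i < G (Suc a0, b0)" "G (Suc a0, b0) \<le> d" if "a0 < d"
    proof -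
      have a1: "Suc a0 \<in> {0<..d}"
        using that by simp
      then have "x (Suc a0) \<noteq> Suc k"
        using free by (metis imageI)
      moreover have "k < x (Suc a0)"
        using mono[OF a0(1) a1] a0(2) by simp
      ultimately have ab: "Suc a0 + b0 \<le> x (Suc a0)"
        using b0 by simp
      show "G (Suc a0, b0) \<le> d"
        using G(1)[OF a1 b0(1) ab] by simp
      show "i < G (Suc a0, b0)"
        using later[OF G(2)[OF a1 b0(1) ab]] b0 ij by auto
    qed
    \<comment> \<open>A recorded neighbour below or to the left bounds \<open>i\<close>. Only the
      first step of the last bead has neither, and there \<open>i + j = d + 1\<close>.\<close>
    have "i \<le> d"
    proof (cases "a0 < d")
      case False
      then have "a0 = d"
        using a0(1) by simp
      show ?thesis
      proof (cases "b0 = 1")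
        case True
        then show ?thesis using b0 \<open>a0 = d\<close> ij by simp
      next
        case False
        then have "1 < b0" using b0(1) by simp
        then show ?thesis using left by simp
      qed
    qed (use below in simp)
    define G' where "G' = G((a0, b0) := i)"
    have "step_record d (q # ss) G'"
      unfolding step_record_def x'
    proof (intro ballI allI impI)
      fix a b assume a: "a \<in> {0<..d}" and b: "1 \<le> b" and ab: "a + b \<le> move_bead d k x a"
      show "G' (a, b) \<in> {1..d} \<and> (G' (a, b), a + b - G' (a, b)) \<in> set (q # ss) \<and>
          (1 < b \<longrightarrow> G' (a, b) \<le> G' (a, b - 1)) \<and> (a < d \<longrightarrow> G' (a, b) < G' (Suc a, b))"
      proof (cases "(a, b) = (a0, b0)")
        case True
        then show ?thesis
          using left below ij b0 \<open>i \<le> d\<close> by (auto simp: G'_def q)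
      next
        case False
        have ab': "a + b \<le> x a"
          using ab False a0 b0 unfolding moved[OF a] by (cases "a = a0") auto
        have "(a, b - 1) \<noteq> (a0, b0)"
          using ab' a0 b0 b by auto
        moreover have "(Suc a, b) \<noteq> (a0, b0)"
          using ab' a0 b0 mono[OF a a0(1)] by auto
        ultimately have "G' (a, b) = G (a, b)" "G' (a, b - 1) = G (a, b - 1)"
          "G' (Suc a, b) = G (Suc a, b)"
          using False unfolding G'_def by (simp_all only: fun_upd_other not_False_eq_True)
        then show ?thesis
          using G[OF a b ab'] by (simp only: list.set insert_iff) blast
      qed
    qed
    then show ?thesis by blast
  qed
qed

lemma tableau_of_beads:
  assumes l: "is_partition l" and sorted: "sorted_wrt read_before W"
    and pos: "\<And>q. q \<in> set W \<Longrightarrow> 1 \<le> fst q \<and> 1 \<le> snd q"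
    and ge: "\<And>a. a \<in> {0<..d} \<Longrightarrow> bead_target l d a \<le> cell_beads d W a"
  shows "\<exists>X. is_tableau l d X \<and> filling_cells l d X \<subseteq> set W"
proof -
  obtain G where "step_record d W G"
    using step_record_exists[OF sorted pos] by blast
  have G: "G (a, b) \<in> {1..d} \<and> (G (a, b), a + b - G (a, b)) \<in> set W \<and>
     (1 < b \<longrightarrow> G (a, b) \<le> G (a, b - 1)) \<and> (a < d \<longrightarrow> G (a, b) < G (Suc a, b))"
    if "(a, b) \<in> shape l d" for a b
  proof -
    have "a \<in> {0<..d}" "1 \<le> b" "a + b \<le> bead_target l d a"
      using that by (auto simp: shape_def bead_target_def)
    then show ?thesis
      using \<open>step_record d W G\<close> ge[of a] unfolding step_record_def by (meson order_trans)
  qed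
  define X where "X p = (if p \<in> shape l d then G p else 0)" for p
  have "is_tableau l d X"
  proof (rule is_tableauI[OF l])
    fix p assume "p \<in> shape l d"
    then show "X p \<in> {1..d}"
      using G[of "fst p" "snd p"] by (simp add: X_def)
  next
    fix a b assume "(a, Suc b) \<in> shape l d" "1 \<le> b"
    moreover from this have "(a, b) \<in> shape l d"
      using shape_row by (metis le_add2 plus_1_eq_Suc)
    ultimately show "X (a, Suc b) \<le> X (a, b)"
      using G[of a "Suc b"] by (simp add: X_def)
  next
    fix a b assume "(a, b) \<in> shape l d" "a < d"
    moreover from this have "(Suc a, b) \<in> shape l d"
      using shape_column[OF l] by simp
    ultimately show "X (a, b) < X (Suc a, b)"
      using G[of a b] by (simp add: X_def)
  qed (simp add: X_def)
  moreover have "filling_cells l d X \<subseteq> set W"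
    using G by (auto simp: filling_cells_def X_def)
  ultimately show ?thesis by blast
qed

lemma beads_ge_target_iff:
  assumes l: "is_partition l" and sorted: "sorted_wrt read_before W"
    and pos: "\<And>q. q \<in> set W \<Longrightarrow> 1 \<le> fst q \<and> 1 \<le> snd q"
  shows "(\<forall>a\<in>{0<..d}. bead_target l d a \<le> cell_beads d W a) \<longleftrightarrow>
    (\<exists>X. is_tableau l d X \<and> filling_cells l d X \<subseteq> set W)" (is "?L \<longleftrightarrow> ?R")
proof
  assume ?L
  then show ?R
    using tableau_of_beads[OF l sorted pos] by blast
next
  assume ?R
  then obtain X where X: "is_tableau l d X" "filling_cells l d X \<subseteq> set W"
    by blast
  show ?L
  proof
    fix a assume a: "a \<in> {0<..d}"
    show "bead_target l d a \<le> cell_beads d W a"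
    proof (cases "part l (d - a + 1) = 0")
      case True
      then show ?thesis using beads_ge by (simp add: bead_target_def)
    next
      case False
      then have "(a, part l (d - a + 1)) \<in> shape l d"
        using a by (auto simp: shape_def)
      then show ?thesis
        using beads_ge_tableau[OF l X sorted] by (simp add: bead_target_def add.commute)
    qed
  qed
qed

section \<open>The reading order of the square word\<close>

lemma sorted_square_word: "sorted_wrt read_before (square_word n)"
proof -
  have "sorted_wrt read_before (concat (map (\<lambda>i. map (Pair i) (rev [1..<n + 1])) is))"
    if "sorted_wrt (<) is" for "is"
    using that
  proof (induction "is")
    case (Cons i "is")
    have "sorted_wrt (>) (rev [1..<n + 1])"
      by (simp add: sorted_wrt_rev sorted_wrt_upt del: upt_Suc)
    then have "sorted_wrt read_before (map (Pair i) (rev [1..<n + 1]))"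
      unfolding sorted_wrt_map by (rule sorted_wrt_mono_rel[rotated]) (simp add: read_before_def)
    moreover have "read_before p q" if "p \<in> set (map (Pair i) (rev [1..<n + 1]))"
      "q \<in> set (concat (map (\<lambda>i. map (Pair i) (rev [1..<n + 1])) is))" for p q
      using that Cons.prems by (auto simp: read_before_def)
    ultimately show ?case
      using Cons by (simp add: sorted_wrt_append del: upt_Suc)
  qed simp
  then show ?thesis
    unfolding square_word_def using sorted_wrt_upt by (simp del: upt_Suc)
qed

lemma set_square_word: "set (square_word n) = grid n"
  by (auto simp: square_word_def grid_def less_Suc_eq_le image_iff Bex_def simp del: upt_Suc)

section \<open>Stable prism tableaux\<close>

definition max_tableau :: "nat list \<Rightarrow> nat \<Rightarrow> cell set \<Rightarrow> cell \<Rightarrow> nat" where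
  "max_tableau l d P p = Max ((\<lambda>X. X p) ` {X. is_tableau l d X \<and> filling_cells l d X \<subseteq> P})"

lemma finite_tableau_entries:
  "finite ((\<lambda>X. X p) ` {X. is_tableau l d X \<and> filling_cells l d X \<subseteq> P})"
proof (rule finite_subset)
  show "(\<lambda>X. X p) ` {X. is_tableau l d X \<and> filling_cells l d X \<subseteq> P} \<subseteq> {0..d}"
  proof (clarsimp)
    fix X assume "is_tableau l d X"
    then show "X p \<le> d"
      using is_tableau_range[of l d X p] is_tableau_zero[of l d X p]
      by (cases "p \<in> shape l d") auto
  qed
qed simp

lemma max_tableau_ge:
  assumes "is_tableau l d X" "filling_cells l d X \<subseteq> P"
  shows "X p \<le> max_tableau l d P p"
  unfolding max_tableau_def using assms by (intro Max_ge[OF finite_tableau_entries]) auto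

lemma max_tableau_attained:
  assumes "is_tableau l d Y" "filling_cells l d Y \<subseteq> P"
  shows "\<exists>X. is_tableau l d X \<and> filling_cells l d X \<subseteq> P \<and> max_tableau l d P p = X p"
proof -
  have "max_tableau l d P p \<in> (\<lambda>X. X p) ` {X. is_tableau l d X \<and> filling_cells l d X \<subseteq> P}"
    unfolding max_tableau_def using assms by (intro Max_in[OF finite_tableau_entries]) auto
  then show ?thesis by blast
qed

text \<open>For each inequality take a tableau that attains the maximum on the smaller side. The
  inequality holds in it, and passing to the maximum only enlarges the other side.\<close>

lemma max_tableau_is_tableau:
  assumes l: "is_partition l" and ex: "is_tableau l d Y" "filling_cells l d Y \<subseteq> P"
  shows "is_tableau l d (max_tableau l d P)"
proof (rule is_tableauI[OF l])
  let ?M = "max_tableau l d P"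
  note attained = max_tableau_attained[OF ex]
  {
    fix p
    obtain X where X: "is_tableau l d X" "?M p = X p"
      using attained by blast
    show "?M p \<in> {1..d}" if "p \<in> shape l d"
      using is_tableau_range[OF X(1) that] X(2) by simp
    show "?M p = 0" if "p \<notin> shape l d"
      using is_tableau_zero[OF X(1) that] X(2) by simp
  next
    fix a b assume ab: "(a, Suc b) \<in> shape l d" "1 \<le> b"
    obtain X where X: "is_tableau l d X" "filling_cells l d X \<subseteq> P" "?M (a, Suc b) = X (a, Suc b)"
      using attained by blast
    have "X (a, Suc b) \<le> X (a, b)"
      using is_tableau_row[OF X(1) shape_row[OF ab(1,2)] ab(1)] by simp
    then show "?M (a, Suc b) \<le> ?M (a, b)"
      using max_tableau_ge[OF X(1,2), of "(a, b)"] X(3) by simp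
  next
    fix a b assume ab: "(a, b) \<in> shape l d" "a < d"
    obtain X where X: "is_tableau l d X" "filling_cells l d X \<subseteq> P" "?M (a, b) = X (a, b)"
      using attained by blast
    have "X (a, b) < X (Suc a, b)"
      using is_tableau_column[OF X(1) ab(1) shape_column[OF l ab(1)], of "Suc a"] ab(2) by simp
    then show "?M (a, b) < ?M (Suc a, b)"
      using max_tableau_ge[OF X(1,2), of "(Suc a, b)"] X(3) by simp
  }
qed

text \<open>The cell named by an entry depends on that entry alone, and every maximal entry occurs
  at the same place in some admissible tableau.\<close>

lemma max_tableau_cells:
  assumes ex: "is_tableau l d Y" "filling_cells l d Y \<subseteq> P"
  shows "filling_cells l d (max_tableau l d P) \<subseteq> P"
proof
  let ?M = "max_tableau l d P"
  fix q assume "q \<in> filling_cells l d ?M"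
  then obtain a b where "(a, b) \<in> shape l d" "q = (?M (a, b), a + b - ?M (a, b))"
    by (auto simp: filling_cells_def)
  moreover obtain X where X: "is_tableau l d X" "filling_cells l d X \<subseteq> P" "?M (a, b) = X (a, b)"
    using max_tableau_attained[OF ex] by blast
  ultimately show "q \<in> P"
    using filling_cellsI[of a b l d X] by auto
qed

lemma image_eq_singleton:
  "A \<noteq> {} \<Longrightarrow> (\<And>x. x \<in> A \<Longrightarrow> f x = y) \<Longrightarrow> f ` A = {y}"
  by auto

text \<open>Transfers a minimality condition from cell sets to the tableaux that produce them, for
  facets and for faces of maximum dimension.\<close>

lemma Collect_image_eq:
  "{h Q | Q. Q \<in> g ` A \<and> (\<forall>R\<in>g ` A. B R Q)} =
    (\<lambda>x. h (g x)) ` {x. x \<in> A \<and> (\<forall>y\<in>A. B (g y) (g x))}"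
  by auto

section \<open>Cells and weights of prism tableaux\<close>

lemma tableau_cells_eq:
  "tableau_cells ls ds T = (\<Union>c<length ls. filling_cells (ls ! c) (ds ! c) (T c))"
  by (fastforce simp: tableau_cells_def has_entry_def filling_cells_def)

lemma prism_tableaux_ext:
  assumes "T \<in> prism_tableaux ls ds" "S \<in> prism_tableaux ls ds"
    and "\<And>c p. c < length ls \<Longrightarrow> p \<in> shape (ls ! c) (ds ! c) \<Longrightarrow> T c p = S c p"
  shows "T = S"
proof (intro ext)
  fix c p
  have "T c p = 0" "S c p = 0" if "\<not> c < length ls"
    using assms(1,2) that by (simp_all add: prism_tableaux_def del: split_paired_All)
  then show "T c p = S c p"
    using assms is_tableau_zero[of "ls ! c" "ds ! c" "T c" p] is_tableau_zero[of "ls ! c" "ds ! c" "S c" p]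
    by (cases "c < length ls"; cases "p \<in> shape (ls ! c) (ds ! c)") (auto simp: prism_tableaux_def)
qed

text \<open>An entry \<open>m\<close> on the antidiagonal \<open>s\<close> covers the cell
  \<open>(m, s - m)\<close>, whatever its colour and place. So antidiagonals containing
  \<open>m\<close> correspond to covered cells in row \<open>m\<close>.\<close>

lemma face_weight_eq_prism_weight:
  assumes "tableau_cells ls ds T \<subseteq> grid n"
    and le: "\<And>c a b t. has_entry ls ds T c (a, b) t \<Longrightarrow> t \<le> a"
  shows "face_weight n (Phi n ls ds T) = prism_weight ls ds T"
proof
  fix m
  have "grid n - Phi n ls ds T = tableau_cells ls ds T"
    using assms(1) by (auto simp: Phi_def face_of_def)
  moreover have "{s. \<exists>c p. has_entry ls ds T c p m \<and> antidiag p = s}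
      = (\<lambda>j. m + j) ` {j. (m, j) \<in> tableau_cells ls ds T}"
  proof (intro set_eqI iffI)
    fix s assume "s \<in> {s. \<exists>c p. has_entry ls ds T c p m \<and> antidiag p = s}"
    then obtain c a b where ab: "has_entry ls ds T c (a, b) m" "s = a + b"
      by (auto simp: antidiag_def)
    then have "(m, a + b - m) \<in> tableau_cells ls ds T"
      by (auto simp: tableau_cells_def)
    moreover have "s = m + (a + b - m)"
      using le[OF ab(1)] ab(2) by simp
    ultimately show "s \<in> (\<lambda>j. m + j) ` {j. (m, j) \<in> tableau_cells ls ds T}"
      by blast
  next
    fix s assume "s \<in> (\<lambda>j. m + j) ` {j. (m, j) \<in> tableau_cells ls ds T}"
    then obtain c a b where ab: "has_entry ls ds T c (a, b) m" "s = m + (a + b - m)"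
      by (auto simp: tableau_cells_def)
    then have "antidiag (a, b) = s"
      using le[OF ab(1)] by (simp add: antidiag_def)
    then show "s \<in> {s. \<exists>c p. has_entry ls ds T c p m \<and> antidiag p = s}"
      using ab(1) by blast
  qed
  ultimately show "face_weight n (Phi n ls ds T) m = prism_weight ls ds T m"
    by (simp add: face_weight_def prism_weight_def card_image)
qed

lemma total_degree_face_weight:
  assumes "F \<subseteq> grid n"
  shows "total_degree (face_weight n F) = card (grid n - F)"
proof -
  have fin: "finite (grid n - F)"
    by (simp add: grid_def)
  have "total_degree (face_weight n F) = (\<Sum>i\<in>{1..n}. face_weight n F i)"
    unfolding total_degree_def
  proof (rule sum.mono_neutral_left)
    show "{m. face_weight n F m \<noteq> 0} \<subseteq> {1..n}"
    proof
      fix m assume "m \<in> {m. face_weight n F m \<noteq> 0}"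
      then have "{j. (m, j) \<in> grid n - F} \<noteq> {}"
        unfolding face_weight_def by (metis (mono_tags, lifting) card.empty mem_Collect_eq)
      then show "m \<in> {1..n}"
        by (auto simp: grid_def)
    qed
  qed auto
  also have "\<dots> = card (SIGMA i:{1..n}. {j. (i, j) \<in> grid n - F})"
    unfolding face_weight_def
    by (rule card_SigmaI[symmetric]) (auto simp: grid_def intro: finite_subset[of _ "{1..n}"])
  also have "(SIGMA i:{1..n}. {j. (i, j) \<in> grid n - F}) = grid n - F"
    by (auto simp: grid_def)
  finally show ?thesis .
qed

section \<open>Complexes of complements of an upward closed family\<close>

definition upward_complements :: "'a set \<Rightarrow> 'a set set \<Rightarrow> 'a set set" where
  "upward_complements U C = {U - P | P. P \<subseteq> U \<and> (\<exists>Q\<in>C. Q \<subseteq> P)}"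

lemma facets_upward_complements:
  assumes C: "\<And>Q. Q \<in> C \<Longrightarrow> Q \<subseteq> U"
  shows "facets (upward_complements U C) = {U - Q | Q. Q \<in> C \<and> (\<forall>R\<in>C. R \<subseteq> Q \<longrightarrow> R = Q)}"
    (is "?L = ?R")
proof (intro set_eqI iffI)
  fix F assume "F \<in> ?L"
  then have F: "F \<in> upward_complements U C" "\<And>G. G \<in> upward_complements U C \<Longrightarrow> F \<subseteq> G \<Longrightarrow> G = F"
    by (auto simp: facets_def)
  then obtain P Q where P: "F = U - P" "P \<subseteq> U" "Q \<in> C" "Q \<subseteq> P"
    by (auto simp: upward_complements_def)
  have max: "U - R = F" if "R \<in> C" "R \<subseteq> P" for R
    using that P(1) C by (intro F(2)) (auto simp: upward_complements_def)
  have "R = Q" if "R \<in> C" "R \<subseteq> Q" for R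
    using max[of R] max[of Q] that P(3,4) C by blast
  then show "F \<in> ?R"
    using max[of Q] P by blast
next
  fix F assume "F \<in> ?R"
  then obtain Q where Q: "F = U - Q" "Q \<in> C" "\<And>R. R \<in> C \<Longrightarrow> R \<subseteq> Q \<Longrightarrow> R = Q"
    by blast
  have "F \<in> upward_complements U C"
    using Q C unfolding upward_complements_def by blast
  moreover have "G = F" if G: "G \<in> upward_complements U C" "F \<subseteq> G" for G
  proof -
    obtain P R where P: "G = U - P" "P \<subseteq> U" "R \<in> C" "R \<subseteq> P"
      using G(1) by (auto simp: upward_complements_def)
    then have "P \<subseteq> Q"
      using G(2) Q(1) by blast
    then have "R = Q"
      using Q(3) P by blast
    then show ?thesis
      using P \<open>P \<subseteq> Q\<close> Q(1) by blast
  qed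
  ultimately show "F \<in> ?L"
    by (simp add: facets_def)
qed

lemma max_dim_faces_upward_complements:
  assumes fin: "finite U" and C: "\<And>Q. Q \<in> C \<Longrightarrow> Q \<subseteq> U"
  shows "max_dim_faces (upward_complements U C) = {U - Q | Q. Q \<in> C \<and> (\<forall>R\<in>C. card Q \<le> card R)}"
    (is "?L = ?R")
proof (intro set_eqI iffI)
  have card: "card (U - P) = card U - card P" "card P \<le> card U" if "P \<subseteq> U" for P
    using that fin by (auto simp: card_Diff_subset finite_subset card_mono)
  {
    fix F assume "F \<in> ?L"
    then have F: "F \<in> upward_complements U C" "\<And>G. G \<in> upward_complements U C \<Longrightarrow> card G \<le> card F"
      by (auto simp: max_dim_faces_def)
    then obtain P Q where P: "F = U - P" "P \<subseteq> U" "Q \<in> C" "Q \<subseteq> P"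
      by (auto simp: upward_complements_def)
    have max: "card P \<le> card R" if "R \<in> C" for R
    proof -
      have "U - R \<in> upward_complements U C"
        using that C unfolding upward_complements_def by blast
      then have "card (U - R) \<le> card (U - P)"
        using F(2) P(1) by simp
      then show ?thesis
        using card[OF P(2)] card[OF C[OF that]] by linarith
    qed
    then have "Q = P"
      using P fin by (metis card_seteq finite_subset)
    then show "F \<in> ?R"
      using P max by blast
  next
    fix F assume "F \<in> ?R"
    then obtain Q where Q: "F = U - Q" "Q \<in> C" "\<And>R. R \<in> C \<Longrightarrow> card Q \<le> card R"
      by blast
    have "F \<in> upward_complements U C"
      using Q C unfolding upward_complements_def by blast
    moreover have "card G \<le> card F" if G: "G \<in> upward_complements U C" for G
    proof -
      obtain P R where P: "G = U - P" "P \<subseteq> U" "R \<in> C" "R \<subseteq> P"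
        using G by (auto simp: upward_complements_def)
      then have "card R \<le> card P"
        using fin by (meson card_mono finite_subset)
      then have "card Q \<le> card P"
        using Q(3)[OF P(3)] by simp
      then show ?thesis
        using P(1) Q(1) card[OF P(2)] card[OF C[OF Q(2)]] by (simp add: diff_le_mono2)
    qed
    ultimately show "F \<in> ?L"
      by (simp add: max_dim_faces_def)
  }
qed

text \<open>Describes facet tableaux without reference to \<open>n\<close>. Different tableaux can
  cover the same cells, so the conclusion compares cell sets and not tableaux.\<close>

definition minimal_cells :: "nat list list \<Rightarrow> nat list \<Rightarrow> filling \<Rightarrow> bool" where
  "minimal_cells ls ds T \<longleftrightarrow> T \<in> prism_tableaux ls ds \<and>
     (\<forall>S\<in>prism_tableaux ls ds. tableau_cells ls ds S \<subseteq> tableau_cells ls ds T \<longrightarrow>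
        tableau_cells ls ds S = tableau_cells ls ds T)"

definition max_filling :: "nat list list \<Rightarrow> nat list \<Rightarrow> cell set \<Rightarrow> filling" where
  "max_filling ls ds P c p = (if c < length ls then max_tableau (ls ! c) (ds ! c) P p else 0)"

text \<open>The size bound is additive to avoid truncated subtraction. It keeps the bead targets
  within \<open>n\<close> and the covered cells within the grid.\<close>

definition bounded_shapes :: "nat list list \<Rightarrow> nat list \<Rightarrow> nat \<Rightarrow> bool" where
  "bounded_shapes ls ds n \<longleftrightarrow> ls \<noteq> [] \<and>
     (\<forall>c<length ls. is_partition (ls ! c) \<and> ds ! c + part (ls ! c) 1 \<le> n)"

lemma shapes_ne: "bounded_shapes ls ds n \<Longrightarrow> ls \<noteq> []"
  by (simp add: bounded_shapes_def)

lemma shapes_part: "bounded_shapes ls ds n \<Longrightarrow> c < length ls \<Longrightarrow> is_partition (ls ! c)"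
  by (simp add: bounded_shapes_def)

lemma shapes_size: "bounded_shapes ls ds n \<Longrightarrow> c < length ls \<Longrightarrow> ds ! c + part (ls ! c) 1 \<le> n"
  by (simp add: bounded_shapes_def)

lemma prism_tableauD:
  "T \<in> prism_tableaux ls ds \<Longrightarrow> c < length ls \<Longrightarrow> is_tableau (ls ! c) (ds ! c) (T c)"
  by (simp add: prism_tableaux_def)

lemma entry_le_row:
  assumes bounded: "bounded_shapes ls ds n"
    and "T \<in> prism_tableaux ls ds" "has_entry ls ds T c (a, b) t"
  shows "t \<le> a"
  using assms tableau_entry_le_row[OF shapes_part[OF bounded] prism_tableauD[OF assms(2)]] by (auto simp: has_entry_def)

lemma tableau_cells_subset_grid:
  assumes bounded: "bounded_shapes ls ds n"
    and T: "T \<in> prism_tableaux ls ds"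
  shows "tableau_cells ls ds T \<subseteq> grid n"
proof
  fix q assume "q \<in> tableau_cells ls ds T"
  then obtain t a b c where q: "q = (t, a + b - t)" and e: "has_entry ls ds T c (a, b) t"
    by (auto simp: tableau_cells_def)
  then have c: "c < length ls" and ab: "(a, b) \<in> shape (ls ! c) (ds ! c)" and t: "T c (a, b) = t"
    by (auto simp: has_entry_def)
  have "1 \<le> t" "t \<le> ds ! c"
    using is_tableau_range[OF prism_tableauD[OF T c] ab] t by auto
  moreover have "t \<le> a"
    using entry_le_row[OF bounded T e] .
  moreover have "b \<le> part (ls ! c) 1" "1 \<le> b" "a \<le> ds ! c"
    using ab part_antimono[OF shapes_part[OF bounded c], of 1 "ds ! c - a + 1"] by (auto simp: shape_def)
  ultimately show "q \<in> grid n"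
    using shapes_size[OF bounded c] unfolding q grid_def by simp arith
qed

section \<open>The faces of the complex in terms of prism tableaux\<close>

lemma corner_sum_asm_of_shapes:
  assumes bounded: "bounded_shapes ls ds n"
    and "i \<le> n" "j \<le> n"
  shows "corner_sum (asm_of_shapes n ls ds) i j =
    Min ((\<lambda>c. int (card {t\<in>{1..i}. grassmannian n (ls ! c) (ds ! c) t \<le> j})) ` {..<length ls})"
proof -
  let ?u = "\<lambda>c. grassmannian n (ls ! c) (ds ! c)"
  have u: "?u c permutes {1..n}" if "c < length ls" for c
    using grassmannian_permutes[OF shapes_part[OF bounded that] shapes_size[OF bounded that]] .
  have eq: "{perm_matrix n (?u c) | c. c < length ls} = (\<lambda>c. perm_matrix n (?u c)) ` {..<length ls}"
    by auto
  have "corner_sum (asm_of_shapes n ls ds) i j =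
      Min ((\<lambda>B. corner_sum B i j) ` (\<lambda>c. perm_matrix n (?u c)) ` {..<length ls})"
    unfolding asm_of_shapes_def eq using assms shapes_ne[OF bounded] u
    by (intro asm_join_corner_sum) (auto intro: corner_function_perm_matrix)
  also have "(\<lambda>B. corner_sum B i j) ` (\<lambda>c. perm_matrix n (?u c)) ` {..<length ls} =
      (\<lambda>c. int (card {t\<in>{1..i}. ?u c t \<le> j})) ` {..<length ls}"
    unfolding image_image using u assms by (intro image_cong) (auto simp: corner_sum_perm_matrix)
  finally show ?thesis .
qed

lemma asm_le_demazure_product_iff:
  assumes bounded: "bounded_shapes ls ds n"
    and P: "P \<subseteq> grid n"
  shows "asm_le (2 * n) (asm_embed n (2 * n) (asm_of_shapes n ls ds))
      (perm_matrix (2 * n) (demazure_product (subword n P)))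
    \<longleftrightarrow> (\<exists>T\<in>prism_tableaux ls ds. tableau_cells ls ds T \<subseteq> P)"
proof -
  let ?A = "asm_of_shapes n ls ds"
  define W where "W = filter (\<lambda>p. p \<in> P) (square_word n)"
  define w where "w = demazure_product (subword n P)"
  have sorted: "sorted_wrt read_before W"
    unfolding W_def by (rule sorted_wrt_filter[OF sorted_square_word])
  have setW: "set W = P"
    using P by (auto simp: W_def set_square_word)
  then have pos: "1 \<le> fst q \<and> 1 \<le> snd q" if "q \<in> set W" for q
    using that P by (auto simp: grid_def)
  have "subword n P = map simple_transp (map cell_index W)"
    by (simp add: subword_def W_def letter_def cell_index_def)
  then have w: "w = demazure_product (map simple_transp (map cell_index W))"
    by (simp add: w_def)
  \<comment> \<open>The last letter index in the grid is \<open>2 * n - 1\<close>, whence the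
    symmetric group of size \<open>2 * n\<close>.\<close>
  have ks: "set (map cell_index W) \<subseteq> {1..<2 * n}"
    using setW P by (fastforce simp: cell_index_def grid_def)
  have perm: "w permutes {1..2 * n}"
    unfolding w by (rule demazure_product_permutes[OF ks])
  have idx: "{..<length ls} \<noteq> {}"
    using shapes_ne[OF bounded] by auto
  have border: "corner_sum ?A i n = int i \<and> corner_sum ?A n i = int i" if "i \<le> n" for i
  proof -
    have "card {t\<in>{1..i}. grassmannian n (ls ! c) (ds ! c) t \<le> n} = i"
      "card {t\<in>{1..n}. grassmannian n (ls ! c) (ds ! c) t \<le> i} = i" if "c < length ls" for c
    proof -
      note u = grassmannian_permutes[OF shapes_part[OF bounded that] shapes_size[OF bounded that]]
      show "card {t\<in>{1..n}. grassmannian n (ls ! c) (ds ! c) t \<le> i} = i"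
        using card_permutes_le[OF u \<open>i \<le> n\<close>] .
      have "grassmannian n (ls ! c) (ds ! c) t \<le> n" if "t \<in> {1..i}" for t
        using permutes_in_image[OF u, of t] that \<open>i \<le> n\<close> by auto
      then have "{t\<in>{1..i}. grassmannian n (ls ! c) (ds ! c) t \<le> n} = {1..i}"
        by blast
      then show "card {t\<in>{1..i}. grassmannian n (ls ! c) (ds ! c) t \<le> n} = i"
        by simp
    qed
    then have "(\<lambda>c. int (card {t\<in>{1..i}. grassmannian n (ls ! c) (ds ! c) t \<le> n})) ` {..<length ls} = {int i}"
      "(\<lambda>c. int (card {t\<in>{1..n}. grassmannian n (ls ! c) (ds ! c) t \<le> i})) ` {..<length ls} = {int i}"
      by (intro image_eq_singleton[OF idx]; simp)+
    then show ?thesis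
      using that by (simp only: corner_sum_asm_of_shapes[OF bounded] order_refl Min_singleton)
  qed
  have "asm_le (2 * n) (asm_embed n (2 * n) ?A) (perm_matrix (2 * n) w) \<longleftrightarrow>
      (\<forall>i\<in>{1..n}. \<forall>j\<in>{1..n}. int (card {t\<in>{1..i}. w t \<le> j}) \<le> corner_sum ?A i j)"
    by (rule asm_le_embed_perm_matrix[OF perm _ border]) simp_all
  \<comment> \<open>The corner sums of the join are minima over the colours, and a number is below a
    minimum iff it is below each term.\<close>
  also have "\<dots> \<longleftrightarrow> (\<forall>c<length ls. \<forall>i\<in>{1..n}. \<forall>j\<in>{1..n}.
      card {t\<in>{1..i}. w t \<le> j} \<le> card {t\<in>{1..i}. grassmannian n (ls ! c) (ds ! c) t \<le> j})"
  proof -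
    have "int (card {t\<in>{1..i}. w t \<le> j}) \<le> corner_sum ?A i j \<longleftrightarrow> (\<forall>c<length ls.
      card {t\<in>{1..i}. w t \<le> j} \<le> card {t\<in>{1..i}. grassmannian n (ls ! c) (ds ! c) t \<le> j})"
      if "i \<in> {1..n}" "j \<in> {1..n}" for i j
    proof -
      have "i \<le> n" "j \<le> n"
        using that by auto
      then show ?thesis
        using idx by (auto simp: corner_sum_asm_of_shapes[OF bounded])
    qed
    then show ?thesis by blast
  qed
  also have "\<dots> \<longleftrightarrow> (\<forall>c<length ls. \<exists>X. is_tableau (ls ! c) (ds ! c) X \<and>
      filling_cells (ls ! c) (ds ! c) X \<subseteq> P)"
  proof -
    have "(\<forall>i\<in>{1..n}. \<forall>j\<in>{1..n}. card {t\<in>{1..i}. w t \<le> j}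
        \<le> card {t\<in>{1..i}. grassmannian n (ls ! c) (ds ! c) t \<le> j}) \<longleftrightarrow>
      (\<exists>X. is_tableau (ls ! c) (ds ! c) X \<and> filling_cells (ls ! c) (ds ! c) X \<subseteq> P)"
      if "c < length ls" for c
      using demazure_product_ge_grassmannian_iff[OF shapes_part[OF bounded that] shapes_size[OF bounded that] ks]
        beads_ge_target_iff[OF shapes_part[OF bounded that] sorted pos, of "ds ! c"]
      unfolding w setW by simp
    then show ?thesis by blast
  qed
  \<comment> \<open>No condition links different colours, so their tableaux can be chosen
    independently and combined.\<close>
  also have "\<dots> \<longleftrightarrow> (\<exists>T\<in>prism_tableaux ls ds. tableau_cells ls ds T \<subseteq> P)"
  proof
    assume "\<forall>c<length ls. \<exists>X. is_tableau (ls ! c) (ds ! c) X \<and> filling_cells (ls ! c) (ds ! c) X \<subseteq> P"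
    then obtain f where f: "\<And>c. c < length ls \<Longrightarrow> is_tableau (ls ! c) (ds ! c) (f c) \<and>
        filling_cells (ls ! c) (ds ! c) (f c) \<subseteq> P"
      by metis
    define T where "T c p = (if c < length ls then f c p else 0)" for c p
    have "T c = f c" if "c < length ls" for c
      using that by (auto simp: T_def)
    then have "T \<in> prism_tableaux ls ds" "tableau_cells ls ds T \<subseteq> P"
      using f by (auto simp: prism_tableaux_def tableau_cells_eq T_def)
    then show "\<exists>T\<in>prism_tableaux ls ds. tableau_cells ls ds T \<subseteq> P" by blast
  next
    assume "\<exists>T\<in>prism_tableaux ls ds. tableau_cells ls ds T \<subseteq> P"
    then obtain T where T: "T \<in> prism_tableaux ls ds" "tableau_cells ls ds T \<subseteq> P"
      by blast
    show "\<forall>c<length ls. \<exists>X. is_tableau (ls ! c) (ds ! c) X \<and> filling_cells (ls ! c) (ds ! c) X \<subseteq> P"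
    proof (intro allI impI exI conjI)
      fix c assume "c < length ls"
      then show "is_tableau (ls ! c) (ds ! c) (T c)" "filling_cells (ls ! c) (ds ! c) (T c) \<subseteq> P"
        using T prism_tableauD[OF T(1)] by (auto simp: tableau_cells_eq)
    qed
  qed
  finally show ?thesis
    unfolding w_def .
qed

lemma subword_complex_eq:
  assumes bounded: "bounded_shapes ls ds n"
  shows "subword_complex n (asm_of_shapes n ls ds)
    = upward_complements (grid n) (tableau_cells ls ds ` prism_tableaux ls ds)"
proof -
  have "(P \<subseteq> grid n \<and> asm_le (2 * n) (asm_embed n (2 * n) (asm_of_shapes n ls ds))
      (perm_matrix (2 * n) (demazure_product (subword n P)))) \<longleftrightarrow>
    (P \<subseteq> grid n \<and> (\<exists>Q\<in>tableau_cells ls ds ` prism_tableaux ls ds. Q \<subseteq> P))" for P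
    using asm_le_demazure_product_iff[OF bounded, of P] by auto
  then show ?thesis
    unfolding subword_complex_def upward_complements_def face_of_def by simp
qed

lemma facets_eq:
  assumes bounded: "bounded_shapes ls ds n"
  shows "facets (subword_complex n (asm_of_shapes n ls ds)) = Phi n ls ds ` {T. minimal_cells ls ds T}"
proof -
  have "facets (subword_complex n (asm_of_shapes n ls ds)) =
      {grid n - Q | Q. Q \<in> tableau_cells ls ds ` prism_tableaux ls ds \<and>
        (\<forall>R\<in>tableau_cells ls ds ` prism_tableaux ls ds. R \<subseteq> Q \<longrightarrow> R = Q)}"
    unfolding subword_complex_eq[OF bounded]
    using tableau_cells_subset_grid[OF bounded] by (intro facets_upward_complements) blast
  also have "\<dots> = Phi n ls ds ` {T. minimal_cells ls ds T}"
    unfolding minimal_cells_def Phi_def face_of_def by (rule Collect_image_eq)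
  finally show ?thesis .
qed

lemma Phi_eq_iff:
  assumes bounded: "bounded_shapes ls ds n"
    and "T \<in> prism_tableaux ls ds" "S \<in> prism_tableaux ls ds"
  shows "Phi n ls ds T = Phi n ls ds S \<longleftrightarrow> tableau_cells ls ds T = tableau_cells ls ds S"
  using tableau_cells_subset_grid[OF bounded assms(2)] tableau_cells_subset_grid[OF bounded assms(3)]
  by (auto simp: Phi_def face_of_def)

lemma StableFacet_eq:
  assumes bounded: "bounded_shapes ls ds n"
  shows "StableFacet n ls ds = {T. minimal_cells ls ds T \<and> \<not> has_unstable_triple ls ds T}"
proof -
  \<comment> \<open>The face determines the covered cells, and minimality depends on nothing
    else.\<close>
  have "Phi n ls ds T \<in> Phi n ls ds ` {T. minimal_cells ls ds T} \<longleftrightarrow> minimal_cells ls ds T"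
    if "T \<in> prism_tableaux ls ds" for T
    using that Phi_eq_iff[OF bounded] by (fastforce simp: minimal_cells_def)
  then show ?thesis
    unfolding StableFacet_def facets_eq[OF bounded] using minimal_cells_def by blast
qed

section \<open>The largest prism tableau inside a set of cells\<close>

lemma max_filling_eq: "c < length ls \<Longrightarrow> max_filling ls ds P c = max_tableau (ls ! c) (ds ! c) P"
  by (auto simp: max_filling_def)

lemma max_filling_prism:
  assumes bounded: "bounded_shapes ls ds n"
    and T: "T \<in> prism_tableaux ls ds" "tableau_cells ls ds T \<subseteq> P"
  shows "max_filling ls ds P \<in> prism_tableaux ls ds"
proof -
  have "is_tableau (ls ! c) (ds ! c) (max_filling ls ds P c)" if "c < length ls" for c
    unfolding max_filling_eq[OF that] using T that
    by (intro max_tableau_is_tableau[OF shapes_part[OF bounded that] prism_tableauD[OF T(1) that]])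
      (auto simp: tableau_cells_eq)
  then show ?thesis
    by (simp add: prism_tableaux_def max_filling_def)
qed

lemma max_filling_cells:
  assumes T: "T \<in> prism_tableaux ls ds" "tableau_cells ls ds T \<subseteq> P"
  shows "tableau_cells ls ds (max_filling ls ds P) \<subseteq> P"
proof -
  have "filling_cells (ls ! c) (ds ! c) (max_filling ls ds P c) \<subseteq> P" if "c < length ls" for c
    unfolding max_filling_eq[OF that] using T that
    by (intro max_tableau_cells[OF prism_tableauD[OF T(1) that]]) (auto simp: tableau_cells_eq)
  then show ?thesis
    unfolding tableau_cells_eq by blast
qed

lemma max_filling_ge:
  assumes T: "T \<in> prism_tableaux ls ds" "tableau_cells ls ds T \<subseteq> P"
  shows "T c p \<le> max_filling ls ds P c p"
proof (cases "c < length ls")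
  case True
  then show ?thesis
    unfolding max_filling_eq[OF True] using T
    by (intro max_tableau_ge[OF prism_tableauD[OF T(1) True]]) (auto simp: tableau_cells_eq)
next
  case False
  then show ?thesis
    using T(1) by (simp add: prism_tableaux_def del: split_paired_All)
qed

lemma max_filling_stable:
  assumes T: "T \<in> prism_tableaux ls ds" "tableau_cells ls ds T \<subseteq> P"
  shows "\<not> has_unstable_triple ls ds (max_filling ls ds P)"
proof
  let ?M = "max_filling ls ds P"
  assume "has_unstable_triple ls ds ?M"
  then obtain c c'' p p'' m m' where e: "has_entry ls ds ?M c p m" "has_entry ls ds ?M c'' p'' m'"
    "antidiag p = antidiag p''" "m < m'" and S: "?M(c := (?M c)(p := m')) \<in> prism_tableaux ls ds"
    unfolding has_unstable_triple_def by blast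
  let ?S = "?M(c := (?M c)(p := m'))"
  obtain a b where p: "p = (a, b)" by (cases p)
  obtain a'' b'' where p'': "p'' = (a'', b'')" by (cases p'')
  have cells: "tableau_cells ls ds ?M \<subseteq> P"
    using max_filling_cells[OF T] .
  have "(m', a'' + b'' - m') \<in> tableau_cells ls ds ?M"
    using e(2) p'' by (auto simp: tableau_cells_def)
  \<comment> \<open>Equal entries on one antidiagonal name the same cell. Raising the entry at
    \<open>p\<close> to \<open>m'\<close> thus stays inside \<open>P\<close> and contradicts
    maximality.\<close>
  then have "(m', a + b - m') \<in> P"
    using cells e(3) by (auto simp: antidiag_def p p'')
  then have "tableau_cells ls ds ?S \<subseteq> P"
    using cells by (fastforce simp: tableau_cells_def has_entry_def p split: if_splits)
  then have "?S c p \<le> ?M c p"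
    by (rule max_filling_ge[OF S])
  then show False
    using e(1,4) by (simp add: has_entry_def)
qed

lemma max_filling_unique:
  assumes bounded: "bounded_shapes ls ds n"
    and min: "minimal_cells ls ds T" and stable: "\<not> has_unstable_triple ls ds T"
  shows "T = max_filling ls ds (tableau_cells ls ds T)"
proof (rule ccontr)
  let ?P = "tableau_cells ls ds T"
  let ?M = "max_filling ls ds ?P"
  assume "T \<noteq> ?M"
  have T: "T \<in> prism_tableaux ls ds"
    using min by (simp add: minimal_cells_def)
  note M = max_filling_prism[OF bounded T order_refl] max_filling_cells[OF T order_refl]
    max_filling_ge[OF T order_refl]
  obtain c p0 where c: "c < length ls" and p0: "p0 \<in> shape (ls ! c) (ds ! c)" "T c p0 \<noteq> ?M c p0"
    using prism_tableaux_ext[OF T M(1)] \<open>T \<noteq> ?M\<close> by blast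
  define l d where "l = ls ! c" and "d = ds ! c"
  have l: "is_partition l"
    unfolding l_def by (rule shapes_part[OF bounded c])
  have X: "is_tableau l d (T c)" and Y: "is_tableau l d (?M c)"
    unfolding l_def d_def using prism_tableauD[OF _ c] T M(1) by auto
  define B where "B = {p \<in> shape l d. T c p < ?M c p}"
  have "p0 \<in> B"
    using p0 M(3)[of c p0] by (auto simp: B_def l_def d_def)
  txt \<open>
    Raising a lowest leftmost deviating entry to its maximal value keeps the filling a prism
    tableau, because the entries to the left and below are already maximal.
  \<close>
  define f where "f p = d + snd p - fst p" for p :: cell
  obtain p where p: "p \<in> B" "\<And>q. q \<in> B \<Longrightarrow> f p \<le> f q"
    using ex_has_least_nat[of "\<lambda>q. q \<in> B" p0 f] \<open>p0 \<in> B\<close> by blast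
  obtain a b where ab: "p = (a, b)" by (cases p)
  have pS: "(a, b) \<in> shape l d" and less: "T c p < ?M c p"
    using p(1) by (auto simp: B_def ab)
  then have a: "1 \<le> a" "a \<le> d" and b: "1 \<le> b"
    by (auto simp: shape_def)
  \<comment> \<open>A step to the left or downwards lowers \<open>f\<close> by 1, the summand
    \<open>d\<close> preventing truncation, so by minimality neither neighbour is in
    \<open>B\<close>.\<close>
  have left: "T c (a, b - 1) = ?M c (a, b - 1)" if "(a, b - 1) \<in> shape l d"
  proof -
    have "(a, b - 1) \<notin> B"
      using p(2)[of "(a, b - 1)"] a b by (auto simp: f_def ab)
    then show ?thesis
      using that M(3)[of c "(a, b - 1)"] by (auto simp: B_def)
  qed
  have below: "T c (Suc a, b) = ?M c (Suc a, b)" if "(Suc a, b) \<in> shape l d"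
  proof -
    have "Suc a \<le> d"
      using that by (simp add: shape_def)
    then have "(Suc a, b) \<notin> B"
      using p(2)[of "(Suc a, b)"] by (auto simp: f_def ab)
    then show ?thesis
      using that M(3)[of c "(Suc a, b)"] by (auto simp: B_def)
  qed
  define m m' where "m = T c p" and "m' = ?M c p"
  define S where "S = T(c := (T c)(p := m'))"
  have "is_tableau l d ((T c)(p := m'))"
  proof (rule is_tableauI[OF l])
    fix q assume "q \<in> shape l d"
    then show "((T c)(p := m')) q \<in> {1..d}"
      using is_tableau_range[OF X, of q] is_tableau_range[OF Y, of q] by (cases "q = p") (simp_all add: m'_def)
  next
    fix q assume "q \<notin> shape l d"
    then show "((T c)(p := m')) q = 0"
      using is_tableau_zero[OF X] pS ab by auto
  next
    fix x y assume xy: "(x, Suc y) \<in> shape l d" "1 \<le> y"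
    then have xy': "(x, y) \<in> shape l d"
      using shape_row[OF xy(1)] by simp
    have "T c (x, Suc y) \<le> T c (x, y)" "?M c (x, Suc y) \<le> ?M c (x, y)"
      using is_tableau_row[OF X xy' xy(1)] is_tableau_row[OF Y xy' xy(1)] by auto
    then show "((T c)(p := m')) (x, Suc y) \<le> ((T c)(p := m')) (x, y)"
      using less left xy' by (auto simp: ab m'_def)
  next
    fix x y assume xy: "(x, y) \<in> shape l d" "x < d"
    then have xy': "(Suc x, y) \<in> shape l d"
      using shape_column[OF l xy(1)] by simp
    have "T c (x, y) < T c (Suc x, y)" "?M c (x, y) < ?M c (Suc x, y)"
      using is_tableau_column[OF X xy(1) xy'] is_tableau_column[OF Y xy(1) xy'] by auto
    then show "((T c)(p := m')) (x, y) < ((T c)(p := m')) (Suc x, y)"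
      using less below xy' by (auto simp: ab m'_def)
  qed
  then have S: "S \<in> prism_tableaux ls ds"
    using T c by (auto simp: prism_tableaux_def S_def l_def d_def)
  have entry_M: "has_entry ls ds ?M c p m'"
    using c pS by (simp add: has_entry_def ab m'_def l_def d_def)
  then have m'P: "(m', a + b - m') \<in> ?P"
    using M(2) ab unfolding tableau_cells_def by blast
  have "tableau_cells ls ds S \<subseteq> ?P"
  proof
    fix q assume "q \<in> tableau_cells ls ds S"
    then obtain t x y c1 where q: "q = (t, x + y - t)" and e: "has_entry ls ds S c1 (x, y) t"
      by (auto simp: tableau_cells_def)
    show "q \<in> ?P"
    proof (cases "c1 = c \<and> (x, y) = p")
      case True
      then show ?thesis
        using e q m'P ab by (auto simp: has_entry_def S_def)
    next
      case False
      then have "has_entry ls ds T c1 (x, y) t"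
        using e by (auto simp: has_entry_def S_def split: if_splits)
      then show ?thesis
        using q by (auto simp: tableau_cells_def)
    qed
  qed
  then have eq: "tableau_cells ls ds S = ?P"
    using min S by (simp add: minimal_cells_def)
  have entry: "has_entry ls ds T c p m"
    using c pS by (simp add: has_entry_def ab m_def l_def d_def)
  then have "(m, a + b - m) \<in> tableau_cells ls ds S"
    unfolding eq using ab by (auto simp: tableau_cells_def)
  then obtain x y c' where e: "a + b - m = x + y - m" and e': "has_entry ls ds S c' (x, y) m"
    by (auto simp: tableau_cells_def)
  have "m \<le> a" "m \<le> x"
    using entry_le_row[OF bounded T] entry entry_le_row[OF bounded S e'] ab by auto
  then have anti: "antidiag p = antidiag (x, y)"
    using e by (simp add: antidiag_def ab)
  have ne': "\<not> (c' = c \<and> (x, y) = p)"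
    using e' less by (auto simp: has_entry_def S_def m_def m'_def)
  then have e2: "has_entry ls ds T c' (x, y) m"
    using e' by (auto simp: has_entry_def S_def split: if_splits)
  have "c' \<noteq> c"
  proof
    assume "c' = c"
    then have xy: "(x, y) \<in> shape l d" and same: "T c (x, y) = T c (a, b)"
      using e2 by (simp_all add: has_entry_def l_def d_def m_def ab)
    have sum: "a + b = x + y"
      using anti by (simp add: ab antidiag_def)
    \<comment> \<open>Within one colour, equal entries on an antidiagonal coincide: going down from
      \<open>(i, j)\<close> to row \<open>i'\<close> increases the entry strictly, and going left
      from there to column \<open>j'\<close> does not decrease it.\<close>
    have "\<not> i < i'" if "(i, j) \<in> shape l d" "(i', j') \<in> shape l d" "i + j = i' + j'"
      "T c (i, j) = T c (i', j')" for i j i' j'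
    proof
      assume "i < i'"
      moreover have "i' \<le> d"
        using that(2) by (simp add: shape_def)
      ultimately have "(i', j) \<in> shape l d"
        using shape_column[OF l that(1)] by simp
      then have "T c (i, j) < T c (i', j)" "T c (i', j) \<le> T c (i', j')"
        using is_tableau_column[OF X that(1)] is_tableau_row[OF X that(2)] that(3) \<open>i < i'\<close>
        by simp_all
      then show False
        using that(4) by simp
    qed
    from this[OF pS xy sum same[symmetric]] this[OF xy pS sum[symmetric] same]
    have "\<not> a < x" "\<not> x < a" .
    then show False
      using ne' \<open>c' = c\<close> sum ab by simp
  qed
  \<comment> \<open>The third entry of the triple: the cell named by \<open>m'\<close> already
    belongs to the cells of \<open>T\<close>, so \<open>T\<close> itself has an entry
    \<open>m'\<close> on this antidiagonal.\<close>
  obtain x'' y'' c'' where e3: "a + b - m' = x'' + y'' - m'" "has_entry ls ds T c'' (x'', y'') m'"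
    using m'P by (auto simp: tableau_cells_def)
  have "m' \<le> a" "m' \<le> x''"
    using entry_le_row[OF bounded M(1)] entry_M entry_le_row[OF bounded T e3(2)] ab by auto
  then have "antidiag p = antidiag (x'', y'')"
    using e3(1) by (simp add: antidiag_def ab)
  then have "has_unstable_triple ls ds T"
    unfolding has_unstable_triple_def
    using entry e2 e3(2) anti \<open>c' \<noteq> c\<close> less S unfolding m_def m'_def S_def by blast
  then show False
    using stable by simp
qed

text \<open>Treats both bijections at once, with \<open>Q\<close> as \<open>minimal_cells\<close> or
  \<open>minimal_prism\<close>. A stable tableau in \<open>Q\<close> is recovered from its cells as
  their \<open>max_filling\<close>, which gives injectivity. Replacing a tableau by that filling
  keeps its cells and hence \<open>Q\<close>, which gives surjectivity.\<close>

lemma bij_betw_stable: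
  assumes bounded: "bounded_shapes ls ds n"
    and "\<And>T. Q T \<Longrightarrow> minimal_cells ls ds T"
    and "\<And>T S. Q T \<Longrightarrow> S \<in> prism_tableaux ls ds \<Longrightarrow> tableau_cells ls ds S = tableau_cells ls ds T \<Longrightarrow> Q S"
  shows "bij_betw (Phi n ls ds) {T. Q T \<and> \<not> has_unstable_triple ls ds T} (Phi n ls ds ` {T. Q T})"
  unfolding bij_betw_def
proof
  show "inj_on (Phi n ls ds) {T. Q T \<and> \<not> has_unstable_triple ls ds T}"
  proof (rule inj_onI)
    fix T S assume "T \<in> {T. Q T \<and> \<not> has_unstable_triple ls ds T}"
      "S \<in> {T. Q T \<and> \<not> has_unstable_triple ls ds T}" and eq: "Phi n ls ds T = Phi n ls ds S"
    then have T: "minimal_cells ls ds T" "\<not> has_unstable_triple ls ds T"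
      and S: "minimal_cells ls ds S" "\<not> has_unstable_triple ls ds S"
      using assms(2) by auto
    then have "tableau_cells ls ds T = tableau_cells ls ds S"
      using eq Phi_eq_iff[OF bounded] by (simp add: minimal_cells_def)
    then show "T = S"
      using max_filling_unique[OF bounded T] max_filling_unique[OF bounded S] by simp
  qed
  show "Phi n ls ds ` {T. Q T \<and> \<not> has_unstable_triple ls ds T} = Phi n ls ds ` {T. Q T}"
  proof
    show "Phi n ls ds ` {T. Q T} \<subseteq> Phi n ls ds ` {T. Q T \<and> \<not> has_unstable_triple ls ds T}"
    proof
      fix F assume "F \<in> Phi n ls ds ` {T. Q T}"
      then obtain T where T: "F = Phi n ls ds T" "Q T"
        by blast
      then have min: "minimal_cells ls ds T"
        using assms(2) by blast
      then have T': "T \<in> prism_tableaux ls ds"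
        by (simp add: minimal_cells_def)
      let ?M = "max_filling ls ds (tableau_cells ls ds T)"
      note M = max_filling_prism[OF bounded T' order_refl] max_filling_cells[OF T' order_refl]
        max_filling_stable[OF T' order_refl]
      have eq: "tableau_cells ls ds ?M = tableau_cells ls ds T"
        using min M(1,2) by (simp add: minimal_cells_def)
      then have "Q ?M"
        using assms(3)[OF T(2) M(1)] by blast
      moreover have "F = Phi n ls ds ?M"
        using eq by (simp add: T(1) Phi_def)
      ultimately show "F \<in> Phi n ls ds ` {T. Q T \<and> \<not> has_unstable_triple ls ds T}"
        using M(3) by blast
    qed
  qed blast
qed

section \<open>Minimal weight and faces of maximum dimension\<close>

lemma prism_weight_eq:
  assumes bounded: "bounded_shapes ls ds n"
    and "T \<in> prism_tableaux ls ds"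
  shows "face_weight n (Phi n ls ds T) = prism_weight ls ds T"
  using face_weight_eq_prism_weight[OF tableau_cells_subset_grid[OF bounded assms(2)]] entry_le_row[OF bounded assms(2)] by blast

lemma total_degree_prism_weight:
  assumes bounded: "bounded_shapes ls ds n"
    and T: "T \<in> prism_tableaux ls ds"
  shows "total_degree (prism_weight ls ds T) = card (tableau_cells ls ds T)"
proof -
  have "grid n - Phi n ls ds T = tableau_cells ls ds T"
    using tableau_cells_subset_grid[OF bounded T] by (auto simp: Phi_def face_of_def)
  then show ?thesis
    using total_degree_face_weight[of "Phi n ls ds T" n] prism_weight_eq[OF bounded T]
    by (simp add: Phi_def face_of_def)
qed

lemma minimal_prism_iff:
  assumes bounded: "bounded_shapes ls ds n"
  shows "minimal_prism ls ds T \<longleftrightarrow> T \<in> prism_tableaux ls ds \<and>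
    (\<forall>S\<in>prism_tableaux ls ds. card (tableau_cells ls ds T) \<le> card (tableau_cells ls ds S))"
  unfolding minimal_prism_def using total_degree_prism_weight[OF bounded] by auto

lemma minimal_prism_imp_minimal_cells:
  assumes bounded: "bounded_shapes ls ds n"
    and "minimal_prism ls ds T"
  shows "minimal_cells ls ds T"
proof -
  have "finite (tableau_cells ls ds T)" if "T \<in> prism_tableaux ls ds" for T
    using tableau_cells_subset_grid[OF bounded that] by (rule finite_subset) (simp add: grid_def)
  then show ?thesis
    using assms unfolding minimal_prism_iff[OF bounded] minimal_cells_def by (meson card_seteq)
qed

lemma max_dim_faces_eq:
  assumes bounded: "bounded_shapes ls ds n"
  shows "max_dim_faces (subword_complex n (asm_of_shapes n ls ds)) = Phi n ls ds ` {T. minimal_prism ls ds T}"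
proof -
  have "max_dim_faces (subword_complex n (asm_of_shapes n ls ds)) =
      {grid n - Q | Q. Q \<in> tableau_cells ls ds ` prism_tableaux ls ds \<and>
        (\<forall>R\<in>tableau_cells ls ds ` prism_tableaux ls ds. card Q \<le> card R)}"
    unfolding subword_complex_eq[OF bounded]
    by (intro max_dim_faces_upward_complements)
      (use tableau_cells_subset_grid[OF bounded] in \<open>auto simp: grid_def\<close>)
  also have "\<dots> = Phi n ls ds ` {T. minimal_prism ls ds T}"
    unfolding minimal_prism_iff[OF bounded] Phi_def face_of_def by (rule Collect_image_eq)
  finally show ?thesis .
qed

theorem theorem4p16:
  fixes ls :: "nat list list" and ds :: "nat list" and n :: nat
  assumes "ls \<noteq> []"
    and "length ds = length ls"
    and "\<And>c. c < length ls \<Longrightarrow> is_partition (ls ! c)"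
    and "\<And>c. c < length ls \<Longrightarrow> 0 < ds ! c"
    and "\<And>c. c < length ls \<Longrightarrow> length (ls ! c) \<le> ds ! c"
    and "\<And>c. c < length ls \<Longrightarrow> int (part (ls ! c) 1) \<le> int n - int (ds ! c)"
  defines "\<Delta> \<equiv> subword_complex n (asm_of_shapes n ls ds)"
  shows "bij_betw (Phi n ls ds) (StableFacet n ls ds) (facets \<Delta>) \<and>
         (\<forall>T\<in>StableFacet n ls ds. face_weight n (Phi n ls ds T) = prism_weight ls ds T) \<and>
         Prism ls ds \<subseteq> StableFacet n ls ds \<and>
         bij_betw (Phi n ls ds) (Prism ls ds) (max_dim_faces \<Delta>)"
proof -
  have "ds ! c + part (ls ! c) 1 \<le> n" if "c < length ls" for c
    using assms(6)[OF that] by linarith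
  then have bounded: "bounded_shapes ls ds n"
    using assms(1,3) by (simp add: bounded_shapes_def)
  have "bij_betw (Phi n ls ds) (StableFacet n ls ds) (facets \<Delta>)"
    unfolding \<Delta>_def StableFacet_eq[OF bounded] facets_eq[OF bounded]
    by (rule bij_betw_stable[OF bounded]) (auto simp: minimal_cells_def)
  moreover have "bij_betw (Phi n ls ds) (Prism ls ds) (max_dim_faces \<Delta>)"
    unfolding \<Delta>_def Prism_def max_dim_faces_eq[OF bounded]
  \<comment> \<open>The total degree of the weight is the number of covered cells, so being a
    minimal prism tableau depends only on these cells.\<close>
  proof (rule bij_betw_stable[OF bounded])
    fix T assume T: "minimal_prism ls ds T"
    then show "minimal_cells ls ds T"
      by (rule minimal_prism_imp_minimal_cells[OF bounded])
    fix S assume "S \<in> prism_tableaux ls ds" "tableau_cells ls ds S = tableau_cells ls ds T"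
    then show "minimal_prism ls ds S"
      using T by (simp add: minimal_prism_iff[OF bounded])
  qed
  moreover have "Prism ls ds \<subseteq> StableFacet n ls ds"
    unfolding Prism_def StableFacet_eq[OF bounded]
    using minimal_prism_imp_minimal_cells[OF bounded] by blast
  moreover have "\<forall>T\<in>StableFacet n ls ds. face_weight n (Phi n ls ds T) = prism_weight ls ds T"
    using prism_weight_eq[OF bounded] by (simp add: StableFacet_def)
  ultimately show ?thesis by blast
qed

end
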